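(* Let $T$ be an isosceles triangle with base angle $\frac{a}{b}\pi$, where $a,b\in\mathbb{Z}$ and $b$ is odd. Let $x\in T$ be a point in the base other than its center. For $\theta\in S^1$ let $\mathrm{Orb}(x,\theta)$ be the trajectory originating from $x$ with direction $\theta$. Then the set of $\theta\in S^1$ such that $f=\mathrm{Orb}(x,\theta)$ is periodic and has the property $$\text{for every periodic trajectory } g \text{ on } T,\quad f'\sim g' \implies f\sim g$$ is nowhere dense in $S^1$. Here $f'$ and $g'$ are the periodic trajectories induced by $f$ and $g$ on the right triangle $T'$ obtained by folding $T$ along its axis of symmetry, and $\sim$ denotes equality of combinatorial types up to reversal.
   Context: Periodic trajectories. For a convex polygon $P\subset\mathbb{C}$, a periodic trajectory on $P$ is a closed billiard path $f:[0,1]\to P$: it moves in straight lines at constant speed, its derivative is reflected across an edge whenever it strikes that edge, and it closes up after time $1$ in both position and direction. $\mathrm{Orb}(x,\theta)$ is the billiard path starting at $x$ in direction $\theta$; when it is periodic it is regarded as a periodic trajectory in this sense. Combinatorial types. The edges of $P$ are labeled. The combinatorial type of a periodic trajectory $f$ is the sequence $\sigma_1\cdots\sigma_k$ of (labels of) edges struck by $f$, in order. Two combinatorial types are considered equivalent if they are identical or one is obtained by reversing the other (that is, by traversing the trajectory backwards, $t\mapsto f(1-t)$). Types differing by a cyclic permutation are not considered equivalent. Write $f\sim g$ if $f$ and $g$ have equivalent combinatorial types. Triangles. $T$ is an isosceles triangle with base labeled $3$ and the two congruent sides labeled $1$ and $2$. $T'$ is the right triangle obtained by identifying each point of $T$ with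 its reflection across the line of symmetry of $T$. Its edges are labeled as follows: $1$ is the hypotenuse (image of the congruent sides), $2$ is the leg lying on the axis of symmetry, and $3$ is the other leg (image of the base). For a periodic trajectory $f$ on $T$, $f'$ denotes the periodic trajectory on $T'$ that is the image of $f$ under this identification. Convention: periodic trajectories on $T$ are required to originate from the base, i.e. at a point of edge $3$. *)

theory Defs
  imports "HOL-Analysis.Analysis"
begin

definition vangle :: "complex \<Rightarrow> complex \<Rightarrow> complex \<Rightarrow> real" where
  "vangle p q r = arccos (((q - p) \<bullet> (r - p)) / (norm (q - p) * norm (r - p)))"

text \<open>Reflection across the line through two distinct points \<open>a\<close> and \<open>b\<close>. A direction
  vector is reflected across an edge of direction \<open>d\<close> by \<open>reflect 0 d\<close>.\<close>

definition reflect :: "complex \<Rightarrow> complex \<Rightarrow> complex \<Rightarrow> complex" where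
  "reflect a b z = a + (b - a) * cnj ((z - a) / (b - a))"

text \<open>A convex polygon with labelled edges is given by the list \<open>vs\<close> of its vertices in cyclic
  order. The labels are \<open>1, \<dots>, length vs\<close>, and the edge labelled \<open>i\<close> joins the \<open>i\<close>-th vertex
  (counted from 1) to the next one.\<close>

definition labels :: "complex list \<Rightarrow> nat set" where
  "labels vs = {1..length vs}"

definition edge_start :: "complex list \<Rightarrow> nat \<Rightarrow> complex" where
  "edge_start vs i = vs ! (i - 1)"

definition edge_end :: "complex list \<Rightarrow> nat \<Rightarrow> complex" where
  "edge_end vs i = vs ! (i mod length vs)"

definition edge :: "complex list \<Rightarrow> nat \<Rightarrow> complex set" where
  "edge vs i = closed_segment (edge_start vs i) (edge_end vs i)"

definition struck :: "complex list \<Rightarrow> complex \<Rightarrow> nat set" where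
  "struck vs z = {i \<in> labels vs. z \<in> edge vs i}"

text \<open>Motion in a straight line with velocity \<open>v\<close> immediately before, respectively after, time \<open>t\<close>.\<close>

definition arrives :: "(real \<Rightarrow> complex) \<Rightarrow> real \<Rightarrow> complex \<Rightarrow> bool" where
  "arrives f t v \<longleftrightarrow> (\<forall>\<^sub>F s in at_left t. f s = f t + (s - t) *\<^sub>R v)"

definition departs :: "(real \<Rightarrow> complex) \<Rightarrow> real \<Rightarrow> complex \<Rightarrow> bool" where
  "departs f t v \<longleftrightarrow> (\<forall>\<^sub>F s in at_right t. f s = f t + (s - t) *\<^sub>R v)"

text \<open>The billiard law: an incoming velocity \<open>v\<close> at the point \<open>z\<close> becomes \<open>w\<close>. It is only
  used at points other than vertices, where at most one edge is struck.\<close>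

definition billiard_law :: "complex list \<Rightarrow> complex \<Rightarrow> complex \<Rightarrow> complex \<Rightarrow> bool" where
  "billiard_law vs z v w \<longleftrightarrow>
     (if struck vs z = {} then w = v
      else \<forall>i\<in>struck vs z. w = reflect 0 (edge_end vs i - edge_start vs i) v)"

text \<open>Only the values of \<open>f\<close> on \<open>{0..1}\<close> matter. A trajectory reaching a vertex is not
  continued, so periodic trajectories avoid the vertices. The last clause says that the path closes
  up in position and direction: the velocity arriving at time 1 becomes, after the reflection that
  takes place if the starting point lies on an edge, the velocity at time 0. In each clause the
  speed \<open>c\<close> is the same.\<close>

definition periodic_trajectory :: "complex list \<Rightarrow> (real \<Rightarrow> complex) \<Rightarrow> bool" where
  "periodic_trajectory vs f \<longleftrightarrow>
     f ` {0..1} \<subseteq> convex hull (set vs) - set vs \<and>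
     (\<exists>c>0.
        (\<forall>t\<in>{0<..<1}. \<exists>v w. norm v = c \<and> arrives f t v \<and> departs f t w \<and>
            billiard_law vs (f t) v w) \<and>
        f 1 = f 0 \<and>
        (\<exists>v w. norm v = c \<and> arrives f 1 v \<and> departs f 0 w \<and> billiard_law vs (f 0) v w))"

text \<open>\<open>is_Orb vs x \<theta> f\<close>: the billiard path that starts at \<open>x\<close> in the direction \<open>\<theta>\<close> is periodic,
  and \<open>f\<close> is the periodic trajectory it defines, where time 1 is the first time at which the path
  is back at \<open>x\<close> with direction \<open>\<theta>\<close>.\<close>

definition is_Orb :: "complex list \<Rightarrow> complex \<Rightarrow> complex \<Rightarrow> (real \<Rightarrow> complex) \<Rightarrow> bool" where
  "is_Orb vs x \<theta> f \<longleftrightarrow>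
     periodic_trajectory vs f \<and> f 0 = x \<and>
     (\<exists>c>0. departs f 0 (c *\<^sub>R \<theta>) \<and>
        (\<forall>t\<in>{0<..<1}. \<not> (f t = x \<and> departs f t (c *\<^sub>R \<theta>))))"

text \<open>The entries of a combinatorial type are the sets of labels of the edges struck at the
  successive strike times. They are singletons \<open>{i}\<close>, standing for the label \<open>i\<close>, unless the path
  meets a vertex. A periodic trajectory on a polygon never does, but its image in the folded triangle
  meets the right-angle vertex whenever the trajectory passes through the centre of the base; the
  legs \<open>2\<close> and \<open>3\<close> are then struck simultaneously, giving the entry \<open>{2, 3}\<close>. The strike at the
  starting point is recorded once, at time 0.\<close>

definition comb_type :: "complex list \<Rightarrow> (real \<Rightarrow> complex) \<Rightarrow> nat set list" where
  "comb_type vs f =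
     map (\<lambda>t. struck vs (f t)) (sorted_list_of_set {t \<in> {0..<1}. struck vs (f t) \<noteq> {}})"

text \<open>Reversal of a type means traversing the trajectory backwards, so that a type starting with
  the label of the edge containing the starting point is reversed to one starting with the same
  label.\<close>

definition same_type :: "complex list \<Rightarrow> (real \<Rightarrow> complex) \<Rightarrow> (real \<Rightarrow> complex) \<Rightarrow> bool" where
  "same_type vs f g \<longleftrightarrow>
     comb_type vs f = comb_type vs g \<or> comb_type vs (reversepath f) = comb_type vs g"

text \<open>The isosceles triangle with base from \<open>p\<close> to \<open>q\<close> and apex \<open>r\<close>: the edges 1, 2, 3 are
  \<open>pr\<close>, \<open>rq\<close> and the base \<open>qp\<close>.\<close>

definition iso_triangle :: "complex \<Rightarrow> complex \<Rightarrow> complex \<Rightarrow> complex list" where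
  "iso_triangle p q r = [p, r, q]"

text \<open>The quotient by the reflection in the axis of symmetry is realised as the half containing
  \<open>p\<close>. Its edges 1, 2, 3 are the hypotenuse, the leg on the axis, and half of the base; the
  quotient map is \<open>fold_map\<close>.\<close>

definition folded_triangle :: "complex \<Rightarrow> complex \<Rightarrow> complex \<Rightarrow> complex list" where
  "folded_triangle p q r = [p, r, midpoint p q]"

definition fold_map :: "complex \<Rightarrow> complex \<Rightarrow> complex \<Rightarrow> complex \<Rightarrow> complex" where
  "fold_map p q r z = (if dist z p \<le> dist z q then z else reflect (midpoint p q) r z)"

definition nowhere_dense_in :: "'a topology \<Rightarrow> 'a set \<Rightarrow> bool" where
  "nowhere_dense_in X S \<longleftrightarrow> S \<subseteq> topspace X \<and> X interior_of (X closure_of S) = {}"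

end

theory Submission
  imports Defs
begin

text \<open>Reflecting a trajectory \<open>f\<close> of the triangle in the axis of symmetry does not change its folded
  image. If the folded image determines the type of \<open>f\<close>, then \<open>f\<close> and its mirror image have the same
  type up to reversal. They cannot have the same type, since the mirror exchanges the sides 1 and 2 and
  no trajectory strikes the base twice in a row; hence the mirror turns the type of \<open>f\<close> into its
  reversal (\<open>rigid_itinerary\<close>).

  Now traverse the mirror image of \<open>f\<close> backwards. This path starts at the mirror image of \<open>x\<close>, strikes
  the same edges in the same order as \<open>f\<close>, and always moves in the same direction as \<open>f\<close>
  (\<open>mirror_companion\<close>). The two paths bound a strip that is folded into the triangle without ever
  containing a vertex. Its width is the distance between \<open>x\<close> and its mirror image, measured across
  the direction \<open>\<theta>\<close>; it is positive unless \<open>\<theta>\<close> is parallel to the base, because \<open>x\<close> is not the centre.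

  Since the base angle is rational, a trajectory takes a bounded number of directions. If \<open>f\<close> strikes
  very often in one period, then two of its strikes lie on the same edge, have the same direction and
  are closer to each other than the width of the strip. The later strike then lies in the strip of the
  earlier one (or conversely), so the displacement between them is repeated over and over and carries
  the path out of the triangle, unless it is zero and \<open>f\<close> has closed up too early (\<open>close_return\<close>). So
  the number of strikes is bounded in terms of the width. Unfolding shows that a closed path is
  determined by its starting point and the word of edges it strikes (\<open>direction_from_word\<close>), so there are only
  finitely many directions \<open>\<theta>\<close> for which the strip is wider than a given \<open>w > 0\<close>
  (\<open>finite_rigid\<close>). Consequently the set of all these \<open>\<theta>\<close> accumulates at most at the two directions of
  the base, and is nowhere dense (\<open>nowhere_dense_if_finite_away\<close>).

  The work with functions of a real parameter is confined to one part, where a periodic trajectory is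
  replaced by the sequence of its strikes (\<open>periodic_itinerary\<close>); everything else is about such
  sequences.\<close>

section \<open>Reflections and the geometry of a convex polygon\<close>

lemma reflect_0: "reflect 0 d v = d * cnj (v / d)"
  by (simp add: reflect_def)

lemma reflect_as_linear: "reflect a b z = a + reflect 0 (b - a) (z - a)"
  by (simp add: reflect_def)

lemma reflect_0_add: "reflect 0 d (v + w) = reflect 0 d v + reflect 0 d w"
  by (simp add: reflect_def add_divide_distrib algebra_simps)

lemma reflect_0_scaleR: "reflect 0 d (s *\<^sub>R v) = s *\<^sub>R reflect 0 d v"
  by (simp add: reflect_def scaleR_conv_of_real)

lemma reflect_0_minus: "reflect 0 d (- v) = - reflect 0 d v"
  by (simp add: reflect_def)

lemma reflect_0_involution: "d \<noteq> 0 \<Longrightarrow> reflect 0 d (reflect 0 d v) = v"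
  by (simp add: reflect_def)

lemma norm_reflect_0: "d \<noteq> 0 \<Longrightarrow> norm (reflect 0 d v) = norm v"
  by (simp add: reflect_def norm_mult norm_divide)

lemma reflect_0_eq_self_iff:
  assumes "d \<noteq> 0"
  shows "reflect 0 d v = v \<longleftrightarrow> (\<exists>s::real. v = s *\<^sub>R d)"
proof
  assume "reflect 0 d v = v"
  then have "cnj (v / d) = v / d"
    using assms by (metis reflect_0 nonzero_mult_div_cancel_left)
  then obtain s where "v / d = complex_of_real s"
    by (metis Reals_cnj_iff Reals_cases)
  then have "v = s *\<^sub>R d"
    using assms by (simp add: scaleR_conv_of_real field_simps)
  then show "\<exists>s::real. v = s *\<^sub>R d" ..
next
  assume "\<exists>s::real. v = s *\<^sub>R d"
  then show "reflect 0 d v = v"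
    using assms by (auto simp: reflect_def scaleR_conv_of_real)
qed

text \<open>The signed area spanned by \<open>v\<close> and \<open>w\<close>; for a unit vector \<open>w\<close> this is the signed length of
  \<open>v\<close> measured across \<open>w\<close>.\<close>

definition cross :: "complex \<Rightarrow> complex \<Rightarrow> real" where
  "cross v w = Im (cnj v * w)"

lemma cross_add_scaleR_right: "cross (v + s *\<^sub>R w) w = cross v w"
  by (simp add: cross_def algebra_simps)

lemma cross_scaleR_left: "cross (s *\<^sub>R v) w = s * cross v w"
  by (simp add: cross_def algebra_simps)

lemma abs_cross_le: "\<bar>cross v w\<bar> \<le> norm v * norm w"
  unfolding cross_def by (metis abs_Im_le_cmod complex_mod_cnj norm_mult)

lemma cross_reflect:
  assumes "d \<noteq> 0"
  shows "cross (reflect 0 d v) (reflect 0 d w) = - cross v w"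
proof -
  have "cnj (reflect 0 d v) * reflect 0 d w = (cnj d * v / d) * (d * (cnj w / cnj d))"
    by (simp add: reflect_def)
  also have "\<dots> = cnj (cnj v * w)"
    using assms by (simp add: field_simps)
  finally show ?thesis
    by (simp add: cross_def)
qed

lemma reflect_0_eq_self_if_cross_eq_0:
  assumes "d \<noteq> 0" "cross d v = 0"
  shows "reflect 0 d v = v"
proof -
  have "cnj (cnj d * v) = cnj d * v"
    using assms(2) by (simp add: cross_def complex_eq_iff)
  then show ?thesis
    using assms(1) by (simp add: reflect_def field_simps)
qed

text \<open>Convexity is expressed by faces: a segment of the polygon with an inner point on an edge lies in that
  edge, and no vertex is an inner point of a segment of the polygon.\<close>

locale convex_polygon =
  fixes vs :: "complex list"
  assumes edge_face: "i \<in> labels vs \<Longrightarrow> edge vs i face_of convex hull set vs"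
    and edge_nondegenerate: "i \<in> labels vs \<Longrightarrow> edge_start vs i \<noteq> edge_end vs i"
    and edges_meet: "i \<in> labels vs \<Longrightarrow> j \<in> labels vs \<Longrightarrow> i \<noteq> j \<Longrightarrow> edge vs i \<inter> edge vs j \<subseteq> set vs"
    and vertex_extreme: "v \<in> set vs \<Longrightarrow> v extreme_point_of (convex hull set vs)"
begin

definition dir :: "nat \<Rightarrow> complex" where
  "dir i = edge_end vs i - edge_start vs i"

lemma dir_nonzero: "i \<in> labels vs \<Longrightarrow> dir i \<noteq> 0"
  using edge_nondegenerate[of i] by (auto simp: dir_def)

lemma edge_subset_hull: "i \<in> labels vs \<Longrightarrow> edge vs i \<subseteq> convex hull set vs"
  using edge_face face_of_imp_subset by blast

lemma edge_diff_parallel: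
  assumes "y \<in> edge vs i" "z \<in> edge vs i"
  shows "\<exists>s::real. y - z = s *\<^sub>R dir i"
proof -
  obtain a b where "y = (1 - a) *\<^sub>R edge_start vs i + a *\<^sub>R edge_end vs i"
    "z = (1 - b) *\<^sub>R edge_start vs i + b *\<^sub>R edge_end vs i"
    using assms by (auto simp: edge_def closed_segment_def)
  then have "y - z = (a - b) *\<^sub>R dir i"
    by (simp only: dir_def) (simp add: algebra_simps)
  then show ?thesis ..
qed

lemma reflect_edge_diff:
  assumes "i \<in> labels vs" "y \<in> edge vs i" "z \<in> edge vs i"
  shows "reflect 0 (dir i) (y - z) = y - z"
  using edge_diff_parallel[OF assms(2,3)] reflect_0_eq_self_iff dir_nonzero[OF assms(1)] by blast

lemma edge_unique:
  assumes "z \<notin> set vs" "i \<in> labels vs" "j \<in> labels vs" "z \<in> edge vs i" "z \<in> edge vs j"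
  shows "i = j"
  using edges_meet assms by blast

lemma ends_in_vs:
  assumes "i \<in> labels vs"
  shows "edge_start vs i \<in> set vs" "edge_end vs i \<in> set vs"
proof -
  have "vs \<noteq> []"
    using assms by (auto simp: labels_def)
  then show "edge_start vs i \<in> set vs" "edge_end vs i \<in> set vs"
    using assms by (auto simp: labels_def edge_start_def edge_end_def)
qed

text \<open>An edge is a face, so a motion along the line of an edge cannot leave the edge without
  leaving the polygon.\<close>

lemma edge_absorbs_parallel:
  assumes i: "i \<in> labels vs" and z: "z \<in> edge vs i" "z \<notin> set vs"
    and par: "reflect 0 (dir i) v = v" and hull: "z + v \<in> convex hull set vs"
  shows "z + v \<in> edge vs i"
proof (cases "v = 0")
  case False
  obtain s where s: "v = s *\<^sub>R dir i"
    using par reflect_0_eq_self_iff dir_nonzero[OF i] by blast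
  with False have "s \<noteq> 0"
    by auto
  obtain a where a: "z = (1 - a) *\<^sub>R edge_start vs i + a *\<^sub>R edge_end vs i" "0 \<le> a" "a \<le> 1"
    using z by (auto simp: edge_def closed_segment_def)
  have "z \<noteq> edge_start vs i" "z \<noteq> edge_end vs i"
    using ends_in_vs[OF i] z by auto
  then have "a \<noteq> 0" "a \<noteq> 1"
    using a by auto
  with a have a01: "0 < a" "a < 1"
    by auto
  \<comment> \<open>Small enough that the backward step \<open>z - e v\<close> stays on the edge; then \<open>z\<close> is interior to a
    segment of the polygon from that point to \<open>z + v\<close>.\<close>
  define e where "e = min a (1 - a) / \<bar>s\<bar>"
  have e: "e > 0"
    using a01 \<open>s \<noteq> 0\<close> by (simp add: e_def)
  have es: "\<bar>e * s\<bar> \<le> min a (1 - a)"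
    using a01 \<open>s \<noteq> 0\<close> by (simp add: e_def abs_mult)
  define y where "y = z - e *\<^sub>R v"
  have y_eq: "y = (1 - (a - e * s)) *\<^sub>R edge_start vs i + (a - e * s) *\<^sub>R edge_end vs i"
    by (simp add: y_def s a(1) dir_def algebra_simps)
  have y: "y \<in> edge vs i"
    unfolding edge_def closed_segment_def using es by (auto intro!: exI[of _ "a - e * s"] y_eq)
  have "z = (1 - e / (1 + e)) *\<^sub>R y + (e / (1 + e)) *\<^sub>R (z + v)"
  proof -
    have "(1 - e / (1 + e)) * e = e / (1 + e)"
      using e by (simp add: field_simps)
    then show ?thesis
      by (simp add: y_def scaleR_right_diff_distrib scaleR_add_right)
         (simp add: algebra_simps)?
  qed
  moreover have "0 < e / (1 + e)" "e / (1 + e) < 1"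
    using e by auto
  moreover have "y \<noteq> z + v"
  proof
    assume "y = z + v"
    then have "(1 + e) *\<^sub>R v = 0"
      by (simp add: y_def algebra_simps add_eq_0_iff)
    then show False
      using e False by auto
  qed
  ultimately have "z \<in> open_segment y (z + v)"
    by (auto simp: in_segment)
  then show ?thesis
    using face_ofD[OF edge_face[OF i]] z y hull edge_subset_hull[OF i] by blast
qed (use z in simp)

text \<open>A ray departing transversally from an edge meets the boundary only once more. If it met it twice,
  the first meeting point would be an inner point of a segment of the polygon; the edge there, being a
  face, would contain the starting point and hence be parallel to the ray.\<close>

lemma next_strike_unique:
  assumes s: "s \<in> labels vs" "z \<in> edge vs s" "z \<notin> set vs" and D: "reflect 0 (dir s) D \<noteq> D"
    and i: "i \<in> labels vs" "z + a *\<^sub>R D \<in> edge vs i"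
    and j: "j \<in> labels vs" "z + b *\<^sub>R D \<in> edge vs j"
    and ab: "0 < a" "0 < b"
  shows "a = b"
proof -
  have *: False if i: "i \<in> labels vs" "z + a *\<^sub>R D \<in> edge vs i"
    and j: "j \<in> labels vs" "z + b *\<^sub>R D \<in> edge vs j" and ab: "0 < a" "a < b"
  for i j a b
  proof -
    have D0: "D \<noteq> 0"
      using D by (auto simp: reflect_def)
    have "z + a *\<^sub>R D = (1 - a / b) *\<^sub>R z + (a / b) *\<^sub>R (z + b *\<^sub>R D)"
      using ab by (simp add: algebra_simps)
    moreover have "0 < a / b" "a / b < 1"
      using ab by auto
    moreover have "z \<noteq> z + b *\<^sub>R D"
      using D0 ab by auto
    ultimately have "z + a *\<^sub>R D \<in> open_segment z (z + b *\<^sub>R D)"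
      unfolding in_segment by blast
    then have "z \<in> edge vs i"
      using face_ofD[OF edge_face[OF i(1)]] i(2) j edge_subset_hull s by blast
    then have "s = i"
      using edge_unique s i by blast
    then have "reflect 0 (dir s) ((z + a *\<^sub>R D) - z) = (z + a *\<^sub>R D) - z"
      using reflect_edge_diff s i by blast
    then have "a *\<^sub>R reflect 0 (dir s) D = a *\<^sub>R D"
      by (simp add: reflect_0_scaleR)
    then show False
      using ab D by simp
  qed
  show ?thesis
    using *[OF i j ab(1)] *[OF j i ab(2)] linorder_neqE[of a b] by blast
qed

text \<open>Vertices are extreme points, so no segment between other points of the polygon passes through one.\<close>

lemma convex_comb_nonvertex:
  assumes "y \<in> convex hull set vs" "z \<in> convex hull set vs" "y \<notin> set vs" "z \<notin> set vs"
    and "0 \<le> l" "l \<le> 1"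
  shows "y + l *\<^sub>R (z - y) \<notin> set vs"
proof
  assume v: "y + l *\<^sub>R (z - y) \<in> set vs"
  have "l \<noteq> 0" "l \<noteq> 1" "y \<noteq> z"
    using v assms by auto
  then have "y + l *\<^sub>R (z - y) \<in> open_segment y z"
    using assms(5,6) by (auto simp: in_segment algebra_simps intro!: exI[of _ l])
  then show False
    using vertex_extreme[OF v] assms by (auto simp: extreme_point_of_def)
qed

lemma convex_comb_edge:
  assumes "y \<in> edge vs i" "z \<in> edge vs i" "0 \<le> l" "l \<le> 1"
  shows "y + l *\<^sub>R (z - y) \<in> edge vs i"
proof -
  have "(1 - l) *\<^sub>R y + l *\<^sub>R z \<in> edge vs i"
    using assms unfolding edge_def by (intro convexD) auto
  then show ?thesis
    by (simp add: algebra_simps)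
qed

section \<open>Itineraries: the sequence of strikes of a billiard path\<close>

text \<open>The discrete form of a billiard path, extended to all times: \<open>F n\<close> is the point of the \<open>n\<close>-th
  strike, \<open>\<sigma> n\<close> the edge struck there, and \<open>D n\<close> the direction after the reflection.\<close>

definition itinerary :: "(nat \<Rightarrow> nat) \<Rightarrow> (nat \<Rightarrow> complex) \<Rightarrow> (nat \<Rightarrow> complex) \<Rightarrow> bool" where
  "itinerary \<sigma> F D \<longleftrightarrow> (\<forall>n.
     \<sigma> n \<in> labels vs \<and> F n \<in> edge vs (\<sigma> n) \<and> F n \<notin> set vs \<and>
     reflect 0 (dir (\<sigma> n)) (D n) \<noteq> D n \<and>
     (\<exists>\<tau>>0. F (Suc n) = F n + \<tau> *\<^sub>R D n) \<and>
     D (Suc n) = reflect 0 (dir (\<sigma> (Suc n))) (D n))"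

context
  fixes \<sigma> F D
  assumes it: "itinerary \<sigma> F D"
begin

lemma itinerary_label: "\<sigma> n \<in> labels vs"
  and itinerary_edge: "F n \<in> edge vs (\<sigma> n)"
  and itinerary_nonvertex: "F n \<notin> set vs"
  and itinerary_transverse: "reflect 0 (dir (\<sigma> n)) (D n) \<noteq> D n"
  and itinerary_turn: "D (Suc n) = reflect 0 (dir (\<sigma> (Suc n))) (D n)"
  using it unfolding itinerary_def by blast+

lemma itinerary_step:
  obtains \<tau> where "\<tau> > 0" "F (Suc n) = F n + \<tau> *\<^sub>R D n"
  using it unfolding itinerary_def by blast

lemma itinerary_hull: "F n \<in> convex hull set vs"
  using itinerary_edge itinerary_label edge_subset_hull by blast

text \<open>A path departs transversally to the edge it has struck, so its next straight piece does not meet the line of that edge again.\<close>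

lemma itinerary_label_Suc: "\<sigma> (Suc n) \<noteq> \<sigma> n"
proof
  assume eq: "\<sigma> (Suc n) = \<sigma> n"
  obtain \<tau> where t: "\<tau> > 0" "F (Suc n) = F n + \<tau> *\<^sub>R D n"
    by (rule itinerary_step)
  have "reflect 0 (dir (\<sigma> n)) (F (Suc n) - F n) = F (Suc n) - F n"
    using reflect_edge_diff itinerary_label itinerary_edge eq by metis
  then show False
    using t itinerary_transverse[of n] by (simp add: reflect_0_scaleR)
qed

end

text \<open>The offset between two itineraries with the same edges and directions, measured across the
  direction of motion, is carried along isometrically; every reflection changes its sign.\<close>

lemma companion_offset:
  assumes F: "itinerary \<sigma> F D" and G: "itinerary \<sigma> G D"
  shows "cross (G n - F n) (D n) = (- 1) ^ n * cross (G 0 - F 0) (D 0)"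
proof (induction n)
  case (Suc n)
  obtain s t where st: "F (Suc n) = F n + s *\<^sub>R D n" "G (Suc n) = G n + t *\<^sub>R D n"
    using itinerary_step[OF F] itinerary_step[OF G] by metis
  let ?R = "reflect 0 (dir (\<sigma> (Suc n)))"
  have l: "\<sigma> (Suc n) \<in> labels vs"
    using itinerary_label[OF F] .
  have "cross (G (Suc n) - F (Suc n)) (D (Suc n)) = cross (?R (G (Suc n) - F (Suc n))) (?R (D n))"
    using reflect_edge_diff[OF l] itinerary_edge[OF F] itinerary_edge[OF G] itinerary_turn[OF F]
    by metis
  also have "\<dots> = - cross (G (Suc n) - F (Suc n)) (D n)"
    using cross_reflect dir_nonzero[OF l] by blast
  also have "cross (G (Suc n) - F (Suc n)) (D n) = cross ((G n - F n) + (t - s) *\<^sub>R D n) (D n)"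
    using st by (simp add: algebra_simps)
  finally show ?case
    using Suc by (simp add: cross_add_scaleR_right)
qed simp

text \<open>The offset is parallel to the edge and its component across the motion is known up to a sign, so it
  depends only on the edge, the direction and the parity of the number of strikes.\<close>

lemma companion_offset_eq:
  assumes F: "itinerary \<sigma> F D" and G: "itinerary \<sigma> G D"
    and ij: "even i \<longleftrightarrow> even j" "\<sigma> i = \<sigma> j" "D i = D j"
  shows "G i - F i = G j - F j"
proof -
  let ?d = "dir (\<sigma> i)"
  have l: "\<sigma> i \<in> labels vs"
    using itinerary_label[OF F] .
  obtain a b where ab: "G i - F i = a *\<^sub>R ?d" "G j - F j = b *\<^sub>R ?d"
    using edge_diff_parallel itinerary_edge[OF F] itinerary_edge[OF G] ij(2) by metis
  have "(- 1 :: real) ^ i = (- 1) ^ j"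
    using ij(1) by (simp add: minus_one_power_iff)
  then have "cross (G i - F i) (D i) = cross (G j - F j) (D i)"
    using companion_offset[OF F G, of i] companion_offset[OF F G, of j] ij(3) by simp
  then have "a * cross ?d (D i) = b * cross ?d (D i)"
    using ab by (simp add: cross_scaleR_left)
  moreover have "cross ?d (D i) \<noteq> 0"
    using reflect_0_eq_self_if_cross_eq_0[OF dir_nonzero[OF l]] itinerary_transverse[OF F] by blast
  ultimately show ?thesis
    using ab by simp
qed

text \<open>The strip between two companions contains no vertex, so a path that enters it in the
  direction of motion keeps its relative position between them.\<close>

lemma strip_invariant:
  assumes F: "itinerary \<sigma> F D" and G: "itinerary \<sigma> G D"
    and start: "\<sigma> j = \<sigma> i" "D j = D i" "F j = F i + l *\<^sub>R (G i - F i)" and l: "0 \<le> l" "l \<le> 1"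
  shows "\<sigma> (j + n) = \<sigma> (i + n) \<and> D (j + n) = D (i + n) \<and>
    F (j + n) = F (i + n) + l *\<^sub>R (G (i + n) - F (i + n))"
proof (induction n)
  case (Suc n)
  let ?i = "i + n" and ?j = "j + n"
  obtain s where s: "s > 0" "F (Suc ?i) = F ?i + s *\<^sub>R D ?i"
    by (rule itinerary_step[OF F])
  obtain t where t: "t > 0" "G (Suc ?i) = G ?i + t *\<^sub>R D ?i"
    by (rule itinerary_step[OF G])
  obtain u where u: "u > 0" "F (Suc ?j) = F ?j + u *\<^sub>R D ?j"
    by (rule itinerary_step[OF F])
  let ?P = "F (Suc ?i) + l *\<^sub>R (G (Suc ?i) - F (Suc ?i))"
  define r where "r = (1 - l) * s + l * t"
  have P: "?P = F ?j + r *\<^sub>R D ?j"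
    using Suc s t by (simp add: r_def algebra_simps)
  have r: "r > 0"
  proof (cases "l = 0")
    case False
    then show ?thesis
      using l s t by (simp add: r_def add_nonneg_pos)
  qed (use s in \<open>simp add: r_def\<close>)
  have PE: "?P \<in> edge vs (\<sigma> (Suc ?i))"
    using convex_comb_edge itinerary_edge[OF F] itinerary_edge[OF G] l by blast
  have PV: "?P \<notin> set vs"
    using convex_comb_nonvertex itinerary_hull[OF F] itinerary_hull[OF G]
      itinerary_nonvertex[OF F] itinerary_nonvertex[OF G] l by blast
  have "u = r"
    using next_strike_unique[OF itinerary_label[OF F] itinerary_edge[OF F]
        itinerary_nonvertex[OF F] itinerary_transverse[OF F], of "\<sigma> (Suc ?j)" ?j u "\<sigma> (Suc ?i)" r]
      itinerary_label[OF F] itinerary_edge[OF F, of "Suc ?j"] PE u r P by metis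
  then have FP: "F (Suc ?j) = ?P"
    using P u by simp
  have \<sigma>: "\<sigma> (Suc ?j) = \<sigma> (Suc ?i)"
    using edge_unique[OF PV] FP PE itinerary_edge[OF F, of "Suc ?j"] itinerary_label[OF F] by metis
  have "D (Suc ?j) = D (Suc ?i)"
    using itinerary_turn[OF F] \<sigma> Suc by simp
  then show ?case
    using FP \<sigma> by simp
qed (use start in simp)

text \<open>A path with a companion at distance \<open>w\<close> never comes back closer than \<open>w\<close> to one of its own
  strikes in the same direction, except by closing up. Otherwise the later strike would lie in the
  strip (or the earlier one in the later strip), the same displacement would occur again after every
  further \<open>j - i\<close> strikes, and the strikes would drift off to infinity along the line of the edge.
  The parities of \<open>i\<close> and \<open>j\<close> must agree, because an odd number of reflections would turn the strip
  over and reverse the displacement.\<close>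

lemma close_return:
  assumes F: "itinerary \<sigma> F D" and G: "itinerary \<sigma> G D"
    and norm: "norm (D i) = 1"
    and w: "\<bar>cross (G 0 - F 0) (D 0)\<bar> \<ge> w"
    and ij: "i < j" "even i \<longleftrightarrow> even j" "\<sigma> i = \<sigma> j" "D i = D j"
    and close: "dist (F i) (F j) < w"
  shows "\<sigma> (j + n) = \<sigma> (i + n) \<and> D (j + n) = D (i + n) \<and> F (j + n) = F (i + n)"
proof -
  let ?e = "G i - F i"
  define m where "m = j - i"
  have jm: "j = i + m" "even m"
    using ij by (auto simp: m_def)
  have "w \<le> \<bar>cross ?e (D i)\<bar>"
    using companion_offset[OF F G, of i] w by (simp add: abs_mult)
  also have "\<dots> \<le> cmod ?e"
    using abs_cross_le[of ?e "D i"] norm by simp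
  finally have we: "w \<le> cmod ?e" .
  have e_pos: "cmod ?e > 0"
    using we close zero_le_dist[of "F i" "F j"] by linarith
  have e_eq: "G j - F j = ?e"
    using companion_offset_eq[OF F G] ij by metis
  obtain l where l: "F j - F i = l *\<^sub>R ?e"
  proof -
    obtain a b where ab: "F j - F i = a *\<^sub>R dir (\<sigma> i)" "?e = b *\<^sub>R dir (\<sigma> i)"
      using edge_diff_parallel itinerary_edge[OF F] itinerary_edge[OF G] ij(3) by metis
    then have "b \<noteq> 0"
      using e_pos by auto
    then have "F j - F i = (a / b) *\<^sub>R ?e"
      using ab by simp
    then show ?thesis ..
  qed
  have l1: "\<bar>l\<bar> \<le> 1"
  proof (rule ccontr)
    assume "\<not> \<bar>l\<bar> \<le> 1"
    then have "1 * cmod ?e \<le> \<bar>l\<bar> * cmod ?e"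
      by (intro mult_right_mono) auto
    also have "\<dots> = dist (F i) (F j)"
      using l by (metis dist_norm norm_minus_commute norm_scaleR)
    finally show False
      using close we by simp
  qed
  \<comment> \<open>For \<open>l \<ge> 0\<close> the later strike lies in the strip of the earlier one; for \<open>l < 0\<close> the roles are
    exchanged, and the equality of the two offsets gives the same conclusion.\<close>
  have same: "\<sigma> (j + n) = \<sigma> (i + n) \<and> D (j + n) = D (i + n) \<and>
      F (j + n) = F (i + n) + l *\<^sub>R (G (i + n) - F (i + n))" for n
  proof (cases "l \<ge> 0")
    case True
    then show ?thesis
      using strip_invariant[OF F G, of j i l n] ij l l1 by (simp add: algebra_simps)
  next
    case False
    have "F i = F j - (F j - F i)"
      by simp
    then have "F i = F j + (- l) *\<^sub>R (G j - F j)"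
      unfolding l e_eq by simp
    then have *: "\<sigma> (i + n) = \<sigma> (j + n) \<and> D (i + n) = D (j + n) \<and>
        F (i + n) = F (j + n) + (- l) *\<^sub>R (G (j + n) - F (j + n))"
      using strip_invariant[OF F G, of i j "- l" n] ij False l1 by simp
    then have "G (j + n) - F (j + n) = G (i + n) - F (i + n)"
      using companion_offset_eq[OF F G, of "j + n" "i + n"] ij(2) by auto
    then show ?thesis
      using * by (metis add_diff_cancel_left' diff_add_cancel scaleR_minus_left add.inverse_inverse
          minus_diff_eq diff_conv_add_uminus)
  qed
  have drift: "\<sigma> (i + q * m) = \<sigma> i \<and> D (i + q * m) = D i \<and> F (i + q * m) = F i + (real q * l) *\<^sub>R ?e" for q
  proof (induction q)
    case (Suc q)
    have e: "G (i + q * m) - F (i + q * m) = ?e"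
      using companion_offset_eq[OF F G, of "i + q * m" i] Suc jm by auto
    have j: "j + q * m = i + Suc q * m"
      using jm by simp
    have "(real (Suc q) * l) *\<^sub>R ?e = (real q * l) *\<^sub>R ?e + l *\<^sub>R ?e"
      by (simp add: scaleR_left_distrib[symmetric] algebra_simps del: scaleR_left_distrib)
    then show ?case
      using same[of "q * m"] Suc unfolding e j by simp
  qed simp
  have "l = 0"
  proof (rule ccontr)
    assume "l \<noteq> 0"
    have "bounded (convex hull set vs)"
      by (simp add: finite_imp_bounded_convex_hull)
    then obtain B where B: "\<And>z. z \<in> convex hull set vs \<Longrightarrow> cmod z \<le> B"
      using bounded_iff by blast
    obtain q where q: "real q * (\<bar>l\<bar> * cmod ?e) > 2 * B"
      using reals_Archimedean3[of "\<bar>l\<bar> * cmod ?e"] \<open>l \<noteq> 0\<close> e_pos by auto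
    have "real q * (\<bar>l\<bar> * cmod ?e) = cmod (F (i + q * m) - F i)"
      using drift[of q] by (simp add: abs_mult)
    also have "\<dots> \<le> cmod (F (i + q * m)) + cmod (F i)"
      by (rule norm_triangle_ineq4)
    also have "\<dots> \<le> 2 * B"
      using B[OF itinerary_hull[OF F]] by (smt (verit))
    finally show False
      using q by simp
  qed
  then show ?thesis
    using same by simp
qed

end

section \<open>From periodic trajectories to itineraries\<close>

lemma departs_iff: "departs f t w \<longleftrightarrow> (\<exists>b>t. \<forall>s. t < s \<longrightarrow> s < b \<longrightarrow> f s = f t + (s - t) *\<^sub>R w)"
  by (auto simp: departs_def eventually_at_right_field)

lemma arrives_iff: "arrives f t v \<longleftrightarrow> (\<exists>b<t. \<forall>s. b < s \<longrightarrow> s < t \<longrightarrow> f s = f t + (s - t) *\<^sub>R v)"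
  by (auto simp: arrives_def eventually_at_left_field)

lemma departs_unique:
  assumes "departs f t v" "departs f t w"
  shows "v = w"
proof -
  have "\<forall>\<^sub>F s in at_right t. f s = f t + (s - t) *\<^sub>R v \<and> f s = f t + (s - t) *\<^sub>R w \<and> s > t"
    using assms unfolding departs_def by (intro eventually_conj) (auto simp: eventually_at_right_less)
  then obtain s where "f s = f t + (s - t) *\<^sub>R v" "f s = f t + (s - t) *\<^sub>R w" "s > t"
    using eventually_happens'[OF trivial_limit_at_right_real] by blast
  then show ?thesis
    by simp
qed

lemma arrives_unique:
  assumes "arrives f t v" "arrives f t w"
  shows "v = w"
proof -
  have "\<forall>\<^sub>F s in at_left t. s < t"
    unfolding eventually_at_left_field by (intro exI[of _ "t - 1"]) auto
  then have "\<forall>\<^sub>F s in at_left t. f s = f t + (s - t) *\<^sub>R v \<and> f s = f t + (s - t) *\<^sub>R w \<and> s < t"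
    using assms unfolding arrives_def by (intro eventually_conj)
  then obtain s where "f s = f t + (s - t) *\<^sub>R v" "f s = f t + (s - t) *\<^sub>R w" "s < t"
    using eventually_happens'[OF trivial_limit_at_left_real] by blast
  then show ?thesis
    by simp
qed

lemma linear_arrives:
  assumes "a < y" "\<And>s. a < s \<Longrightarrow> s \<le> y \<Longrightarrow> f s = z + (s - x) *\<^sub>R w"
  shows "arrives f y w"
proof -
  have "f s = f y + (s - y) *\<^sub>R w" if "a < s" "s < y" for s
    using assms(1) that by (simp only: assms(2)[of s] assms(2)[of y]) (simp add: algebra_simps)
  then show ?thesis
    unfolding arrives_iff using assms(1) by blast
qed

lemma linear_departs:
  assumes "y < b" "\<And>s. y \<le> s \<Longrightarrow> s < b \<Longrightarrow> f s = z + (s - x) *\<^sub>R w"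
  shows "departs f y w"
proof -
  have "f s = f y + (s - y) *\<^sub>R w" if "y < s" "s < b" for s
    using assms(1) that by (simp only: assms(2)[of s] assms(2)[of y]) (simp add: algebra_simps)
  then show ?thesis
    unfolding departs_iff using assms(1) by blast
qed

lemma departs_nearby:
  assumes "departs f x w"
  obtains b where "b > x"
    "\<And>y. x < y \<Longrightarrow> y < b \<Longrightarrow> f y = f x + (y - x) *\<^sub>R w \<and> arrives f y w \<and> departs f y w"
proof -
  obtain b where b: "b > x" "\<And>s. x < s \<Longrightarrow> s < b \<Longrightarrow> f s = f x + (s - x) *\<^sub>R w"
    using assms departs_iff by metis
  have "f y = f x + (y - x) *\<^sub>R w \<and> arrives f y w \<and> departs f y w" if "x < y" "y < b" for y
    using that b linear_arrives[of x y f "f x" x w] linear_departs[of y b f "f x" x w] by auto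
  then show ?thesis
    using that b(1) by blast
qed

lemma arrives_nearby:
  assumes "arrives f x v"
  obtains b where "b < x"
    "\<And>y. b < y \<Longrightarrow> y < x \<Longrightarrow> f y = f x + (y - x) *\<^sub>R v \<and> arrives f y v \<and> departs f y v"
proof -
  obtain b where b: "b < x" "\<And>s. b < s \<Longrightarrow> s < x \<Longrightarrow> f s = f x + (s - x) *\<^sub>R v"
    using assms arrives_iff by metis
  have "f y = f x + (y - x) *\<^sub>R v \<and> arrives f y v \<and> departs f y v" if "b < y" "y < x" for y
    using that b linear_arrives[of b y f "f x" x v] linear_departs[of y x f "f x" x v] by auto
  then show ?thesis
    using that b(1) by blast
qed

text \<open>A periodic trajectory with the speed \<open>c\<close> fixed. The velocities are not chosen: the laws hold for
  whichever velocities the path has, which is the same thing since these are unique.\<close>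

locale periodic_billiard = convex_polygon +
  fixes f :: "real \<Rightarrow> complex" and c :: real
  assumes c_pos: "c > 0"
    and path_hull: "t \<in> {0..1} \<Longrightarrow> f t \<in> convex hull set vs"
    and path_nonvertex: "t \<in> {0..1} \<Longrightarrow> f t \<notin> set vs"
    and path_departs: "t \<in> {0..<1} \<Longrightarrow> \<exists>w. norm w = c \<and> departs f t w"
    and path_arrives: "t \<in> {0<..1} \<Longrightarrow> \<exists>v. norm v = c \<and> arrives f t v"
    and path_law: "t \<in> {0<..<1} \<Longrightarrow> arrives f t v \<Longrightarrow> departs f t w \<Longrightarrow> billiard_law vs (f t) v w"
    and path_closed: "f 1 = f 0"
    and path_closing_law: "arrives f 1 v \<Longrightarrow> departs f 0 w \<Longrightarrow> billiard_law vs (f 0) v w"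

lemma (in convex_polygon) periodic_billiardI:
  assumes "periodic_trajectory vs f"
  shows "\<exists>c. periodic_billiard vs f c"
proof -
  obtain c where c: "c > 0" and
    mid: "\<And>t. t \<in> {0<..<1} \<Longrightarrow> \<exists>v w. norm v = c \<and> arrives f t v \<and> departs f t w \<and> billiard_law vs (f t) v w"
    and closed: "f 1 = f 0"
    and ends: "\<exists>v w. norm v = c \<and> arrives f 1 v \<and> departs f 0 w \<and> billiard_law vs (f 0) v w"
    and img: "f ` {0..1} \<subseteq> convex hull (set vs) - set vs"
    using assms unfolding periodic_trajectory_def by blast
  have norm_law: "norm w = norm v" if "billiard_law vs z v w" for z v w
  proof (cases "struck vs z = {}")
    case False
    then obtain i where i: "i \<in> struck vs z"
      by blast
    then have "i \<in> labels vs" "w = reflect 0 (dir i) v"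
      using that False unfolding billiard_law_def dir_def by (auto simp: struck_def)
    then show ?thesis
      using norm_reflect_0 dir_nonzero by blast
  qed (use that in \<open>simp add: billiard_law_def\<close>)
  have "\<exists>w. norm w = c \<and> departs f t w" if "t \<in> {0..<1}" for t
  proof (cases "t = 0")
    case True
    then show ?thesis
      using ends norm_law by metis
  next
    case False
    then have "t \<in> {0<..<1}"
      using that by auto
    then show ?thesis
      using mid norm_law by metis
  qed
  moreover have "\<exists>v. norm v = c \<and> arrives f t v" if "t \<in> {0<..1}" for t
  proof (cases "t = 1")
    case True
    then show ?thesis
      using ends by metis
  next
    case False
    then have "t \<in> {0<..<1}"
      using that by auto
    then show ?thesis
      using mid by metis
  qed
  moreover have "billiard_law vs (f t) v w" if "t \<in> {0<..<1}" "arrives f t v" "departs f t w" for t v w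
    using mid[OF that(1)] that arrives_unique departs_unique by metis
  moreover have "billiard_law vs (f 0) v w" if "arrives f 1 v" "departs f 0 w" for v w
    using ends that arrives_unique departs_unique by metis
  ultimately have "periodic_billiard vs f c"
    using c closed img by unfold_locales blast+
  then show ?thesis ..
qed

context periodic_billiard
begin

lemma law_at_strike:
  assumes "billiard_law vs z v w" "i \<in> labels vs" "z \<in> edge vs i"
  shows "w = reflect 0 (dir i) v"
  using assms by (auto simp: billiard_law_def struck_def dir_def split: if_splits)

text \<open>Sliding along an edge is a property that persists, both forwards and backwards in time: the edge
  absorbs the motion, and the reflection in the edge does not change the velocity. A path that did it
  once would be a straight line, which does not close up.\<close>

lemma no_grazing:
  assumes t0: "t0 \<in> {0<..<1}" and i: "i \<in> labels vs" and edge: "f t0 \<in> edge vs i"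
    and v: "arrives f t0 v" "departs f t0 v"
  shows False
proof -
  have par: "reflect 0 (dir i) v = v"
    using law_at_strike[OF path_law[OF t0 v] i edge] by simp
  have par': "reflect 0 (dir i) (s *\<^sub>R v) = s *\<^sub>R v" for s
    using par by (simp add: reflect_0_scaleR)
  have slide: "f x \<in> edge vs i"
    if "y \<in> {0..1}" "x \<in> {0..1}" "f x = f y + s *\<^sub>R v" "f y \<in> edge vs i" for x y s
    using edge_absorbs_parallel[OF i that(4) path_nonvertex[OF that(1)] par'[of s]]
      path_hull[OF that(2)] that(3) by simp
  define H where "H t \<longleftrightarrow> f t \<in> edge vs i \<and> (0 < t \<longrightarrow> arrives f t v) \<and> (t < 1 \<longrightarrow> departs f t v)" for t
  have right: "\<exists>b>x. \<forall>y. x < y \<longrightarrow> y < b \<longrightarrow> (H y \<longleftrightarrow> H x)" if x: "x \<in> {0..<1}" for x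
  proof -
    obtain w where w: "departs f x w"
      using path_departs[OF x] by blast
    obtain b where b: "b > x"
      "\<And>y. x < y \<Longrightarrow> y < b \<Longrightarrow> f y = f x + (y - x) *\<^sub>R w \<and> arrives f y w \<and> departs f y w"
      using departs_nearby[OF w] by metis
    have "H y \<longleftrightarrow> H x" if y: "x < y" "y < min b 1" for y
    proof
      assume H: "H y"
      have fy: "f y = f x + (y - x) *\<^sub>R w" "arrives f y w"
        using b(2) y by auto
      have wv: "w = v"
        using H fy y x arrives_unique by (auto simp: H_def)
      have fx: "f x \<in> edge vs i"
      proof (rule slide[of y x "- (y - x)"])
        show "f x = f y + (- (y - x)) *\<^sub>R v"
          by (simp only: fy(1) wv scaleR_minus_left) simp
      qed (use H x y in \<open>auto simp: H_def\<close>)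
      have "arrives f x v" if "0 < x"
      proof -
        obtain u where u: "arrives f x u"
          using path_arrives[of x] x \<open>0 < x\<close> by auto
        have "w = reflect 0 (dir i) u"
          using law_at_strike[OF path_law[OF _ u w] i fx] x \<open>0 < x\<close> by simp
        then have "u = v"
          using reflect_0_involution[OF dir_nonzero[OF i], of u] par wv by simp
        then show ?thesis
          using u by simp
      qed
      then show "H x"
        using fx w wv by (simp add: H_def)
    next
      assume H: "H x"
      then have wv: "w = v"
        using w x departs_unique by (auto simp: H_def)
      then show "H y"
        using slide[of x y "y - x"] b(2)[of y] H x y by (simp add: H_def)
    qed
    then show ?thesis
      using b(1) x by (intro exI[of _ "min b 1"]) auto
  qed
  have left: "\<exists>b<x. \<forall>y. b < y \<longrightarrow> y < x \<longrightarrow> (H y \<longleftrightarrow> H x)" if x: "x \<in> {0<..1}" for x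
  proof -
    obtain u where u: "arrives f x u"
      using path_arrives[OF x] by blast
    obtain b where b: "b < x"
      "\<And>y. b < y \<Longrightarrow> y < x \<Longrightarrow> f y = f x + (y - x) *\<^sub>R u \<and> arrives f y u \<and> departs f y u"
      using arrives_nearby[OF u] by metis
    have "H y \<longleftrightarrow> H x" if y: "max b 0 < y" "y < x" for y
    proof
      assume H: "H y"
      have fy: "f y = f x + (y - x) *\<^sub>R u" "arrives f y u"
        using b(2) y by auto
      have uv: "u = v"
        using H fy y x arrives_unique by (auto simp: H_def)
      have fx: "f x \<in> edge vs i"
      proof (rule slide[of y x "- (y - x)"])
        show "f x = f y + (- (y - x)) *\<^sub>R v"
          by (simp only: fy(1) uv scaleR_minus_left) simp
      qed (use H x y in \<open>auto simp: H_def\<close>)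
      have "departs f x v" if "x < 1"
      proof -
        obtain w where w: "departs f x w"
          using path_departs[of x] x \<open>x < 1\<close> by auto
        have "w = reflect 0 (dir i) u"
          using law_at_strike[OF path_law[OF _ u w] i fx] x \<open>x < 1\<close> by simp
        then show ?thesis
          using w par uv by simp
      qed
      then show "H x"
        using fx u uv by (simp add: H_def)
    next
      assume H: "H x"
      then have uv: "u = v"
        using u x arrives_unique by (auto simp: H_def)
      then show "H y"
        using slide[of x y "y - x"] b(2)[of y] H x y by (simp add: H_def)
    qed
    then show ?thesis
      using b(1) x by (intro exI[of _ "max b 0"]) auto
  qed
  have H_const: "0 \<le> a \<longrightarrow> b \<le> 1 \<longrightarrow> (H a \<longleftrightarrow> H b)" if "a \<le> b" for a b :: real
    using that
  proof (induction rule: Bolzano)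
    case (local x)
    show ?case
    proof (cases "0 \<le> x \<and> x \<le> 1")
      case x: True
      obtain d1 where d1: "d1 > 0" "\<And>y. x < y \<Longrightarrow> y < x + d1 \<Longrightarrow> y \<le> 1 \<Longrightarrow> H y \<longleftrightarrow> H x"
      proof (cases "x < 1")
        case True
        then obtain b where "b > x" "\<forall>y. x < y \<longrightarrow> y < b \<longrightarrow> (H y \<longleftrightarrow> H x)"
          using right x by auto
        then show ?thesis
          using that[of "b - x"] by auto
      qed (use that[of 1] in auto)
      obtain d2 where d2: "d2 > 0" "\<And>y. x - d2 < y \<Longrightarrow> y < x \<Longrightarrow> 0 \<le> y \<Longrightarrow> H y \<longleftrightarrow> H x"
      proof (cases "0 < x")
        case True
        then obtain b where "b < x" "\<forall>y. b < y \<longrightarrow> y < x \<longrightarrow> (H y \<longleftrightarrow> H x)"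
          using left x by auto
        then show ?thesis
          using that[of "x - b"] by auto
      qed (use that[of 1] in auto)
      have "0 \<le> a \<longrightarrow> b \<le> 1 \<longrightarrow> (H a \<longleftrightarrow> H b)" if "a \<le> x \<and> x \<le> b \<and> b - a < min d1 d2" for a b
        using that d1(2)[of b] d2(2)[of a] by (cases "a = x"; cases "b = x") auto
      then show ?thesis
        using d1(1) d2(1) by (intro exI[of _ "min d1 d2"]) auto
    qed (auto intro!: exI[of _ 1])
  qed auto
  have H0: "H t0"
    using edge v by (simp add: H_def)
  have H: "H t" if "t \<in> {0..1}" for t
    using H_const[of t t0] H_const[of t0 t] H0 t0 that by (cases "t \<le> t0") auto
  have linear: "0 \<le> a \<longrightarrow> b \<le> 1 \<longrightarrow> f b = f a + (b - a) *\<^sub>R v" if "a \<le> b" for a b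
    using that
  proof (induction rule: Bolzano)
    case (local x)
    obtain d1 where d1: "d1 > 0"
      "\<And>y. x < y \<Longrightarrow> y < x + d1 \<Longrightarrow> 0 \<le> x \<Longrightarrow> y \<le> 1 \<Longrightarrow> f y = f x + (y - x) *\<^sub>R v"
    proof (cases "0 \<le> x \<and> x < 1")
      case True
      then have "departs f x v"
        using H[of x] by (auto simp: H_def)
      then obtain b where "b > x" "\<And>y. x < y \<Longrightarrow> y < b \<Longrightarrow> f y = f x + (y - x) *\<^sub>R v"
        using departs_nearby by metis
      then show ?thesis
        using that[of "b - x"] by auto
    qed (use that[of 1] in auto)
    obtain d2 where d2: "d2 > 0"
      "\<And>y. x - d2 < y \<Longrightarrow> y < x \<Longrightarrow> 0 \<le> y \<Longrightarrow> x \<le> 1 \<Longrightarrow> f y = f x + (y - x) *\<^sub>R v"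
    proof (cases "0 < x \<and> x \<le> 1")
      case True
      then have "arrives f x v"
        using H[of x] by (auto simp: H_def)
      then obtain b where "b < x" "\<And>y. b < y \<Longrightarrow> y < x \<Longrightarrow> f y = f x + (y - x) *\<^sub>R v"
        using arrives_nearby by metis
      then show ?thesis
        using that[of "x - b"] by auto
    qed (use that[of 1] in auto)
    have "0 \<le> a \<longrightarrow> b \<le> 1 \<longrightarrow> f b = f a + (b - a) *\<^sub>R v" if "a \<le> x \<and> x \<le> b \<and> b - a < min d1 d2" for a b
    proof (intro impI)
      assume "0 \<le> a" "b \<le> 1"
      then have "f b = f x + (b - x) *\<^sub>R v" "f a = f x + (a - x) *\<^sub>R v"
        using that d1(2)[of b] d2(2)[of a] by (cases "a = x"; cases "b = x"; simp)+
      then show "f b = f a + (b - a) *\<^sub>R v"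
        by (simp only:) (simp add: algebra_simps)
    qed
    then show ?case
      using d1(1) d2(1) by (intro exI[of _ "min d1 d2"]) auto
  next
    case (trans a b c)
    have "f a + (b - a) *\<^sub>R v + (c - b) *\<^sub>R v = f a + (c - a) *\<^sub>R v"
      by (simp add: algebra_simps)
    then show ?case
      using trans by auto
  qed
  then have "v = 0"
    using linear[of 0 1] path_closed by simp
  moreover have "norm v = c"
    using path_arrives[of t0] t0 v(1) arrives_unique by (metis greaterThanAtMost_iff greaterThanLessThan_iff less_imp_le)
  ultimately show False
    using c_pos by simp
qed

lemma no_strike_on_segment:
  assumes "t \<in> {0<..<1}" "arrives f t v" "departs f t v"
  shows "struck vs (f t) = {}"
  using no_grazing[OF assms(1) _ _ assms(2,3)] by (auto simp: struck_def)

text \<open>Close to a given time, before and after it, the path is straight, and a straight piece has no strike in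
  its interior because that would be grazing. With compactness this makes the strikes finite in number.\<close>

lemma strikes_isolated:
  assumes x: "x \<in> {0..1}"
  shows "\<exists>d>0. \<forall>y\<in>{0..1}. \<bar>y - x\<bar> < d \<longrightarrow> y \<noteq> x \<longrightarrow> struck vs (f y) = {}"
proof -
  obtain d1 where d1: "d1 > 0" "\<And>y. x < y \<Longrightarrow> y < x + d1 \<Longrightarrow> y \<le> 1 \<Longrightarrow> struck vs (f y) = {}"
  proof (cases "x < 1")
    case True
    then obtain w where "departs f x w"
      using path_departs[of x] x by auto
    then obtain b where b: "b > x"
      "\<And>y. x < y \<Longrightarrow> y < b \<Longrightarrow> f y = f x + (y - x) *\<^sub>R w \<and> arrives f y w \<and> departs f y w"
      by (rule departs_nearby) blast
    then have "struck vs (f y) = {}" if "x < y" "y < min b 1" for y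
      using no_strike_on_segment[of y w] that x by auto
    then show ?thesis
      using that[of "min b 1 - x"] b(1) True by auto
  qed (use that[of 1] in auto)
  obtain d2 where d2: "d2 > 0" "\<And>y. x - d2 < y \<Longrightarrow> y < x \<Longrightarrow> 0 \<le> y \<Longrightarrow> struck vs (f y) = {}"
  proof (cases "0 < x")
    case True
    then obtain w where "arrives f x w"
      using path_arrives[of x] x by auto
    then obtain b where b: "b < x"
      "\<And>y. b < y \<Longrightarrow> y < x \<Longrightarrow> f y = f x + (y - x) *\<^sub>R w \<and> arrives f y w \<and> departs f y w"
      by (rule arrives_nearby) blast
    then have "struck vs (f y) = {}" if "max b 0 < y" "y < x" for y
      using no_strike_on_segment[of y w] that x by auto
    then show ?thesis
      using that[of "x - max b 0"] b(1) True by auto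
  qed (use that[of 1] in auto)
  have "struck vs (f y) = {}" if "y \<in> {0..1}" "\<bar>y - x\<bar> < min d1 d2" "y \<noteq> x" for y
    using d1(2)[of y] d2(2)[of y] that by (cases "x < y") auto
  then show ?thesis
    using d1(1) d2(1) by (intro exI[of _ "min d1 d2"]) auto
qed

lemma finite_strikes: "finite {t \<in> {0..1}. struck vs (f t) \<noteq> {}}"
proof -
  have "0 \<le> a \<longrightarrow> b \<le> 1 \<longrightarrow> finite {t \<in> {a..b}. struck vs (f t) \<noteq> {}}" if "a \<le> b" for a b
    using that
  proof (induction rule: Bolzano)
    case (trans a b c)
    have sub: "{t \<in> {a..c}. struck vs (f t) \<noteq> {}} \<subseteq>
        {t \<in> {a..b}. struck vs (f t) \<noteq> {}} \<union> {t \<in> {b..c}. struck vs (f t) \<noteq> {}}"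
      by auto
    show ?case
    proof (intro impI)
      assume "0 \<le> a" "c \<le> 1"
      then show "finite {t \<in> {a..c}. struck vs (f t) \<noteq> {}}"
        using trans by (intro finite_subset[OF sub] finite_UnI) auto
    qed
  next
    case (local x)
    obtain d where d: "d > 0"
      "x \<in> {0..1} \<longrightarrow> (\<forall>y\<in>{0..1}. \<bar>y - x\<bar> < d \<longrightarrow> y \<noteq> x \<longrightarrow> struck vs (f y) = {})"
      using strikes_isolated[of x] zero_less_one by metis
    have "finite {t \<in> {a..b}. struck vs (f t) \<noteq> {}}"
      if "a \<le> x \<and> x \<le> b \<and> b - a < d" "0 \<le> a" "b \<le> 1" for a b
      by (rule finite_subset[of _ "{x}"]) (use d(2) that in auto)
    then show ?case
      using d(1) by blast
  qed
  from this[of 0 1] show ?thesis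
    by simp
qed

text \<open>The velocity is locally constant where nothing is struck. The passage from local to global is the
  compactness principle \<open>Bolzano\<close> for a property of intervals that is additive.\<close>

lemma linear_between_strikes:
  assumes st: "0 \<le> s" "s < t" "t \<le> 1"
    and free: "\<And>u. s < u \<Longrightarrow> u < t \<Longrightarrow> struck vs (f u) = {}" and w: "departs f s w"
  shows "f t = f s + (t - s) *\<^sub>R w \<and> arrives f t w"
proof -
  define P where "P a b \<longleftrightarrow> (s \<le> a \<longrightarrow> b \<le> t \<longrightarrow> a < b \<longrightarrow>
    (\<exists>v. f b = f a + (b - a) *\<^sub>R v \<and> departs f a v \<and> arrives f b v))" for a b
  have trans: "P a c" if P: "P a b" "P b c" and le: "a \<le> b" "b \<le> c" for a b c
  proof (cases "s \<le> a \<and> a < b \<and> b < c \<and> c \<le> t")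
    case True
    then obtain v v' where v: "f b = f a + (b - a) *\<^sub>R v" "departs f a v" "arrives f b v"
      and v': "f c = f b + (c - b) *\<^sub>R v'" "departs f b v'" "arrives f c v'"
      using P le by (auto simp: P_def)
    have "billiard_law vs (f b) v v'"
      using path_law[of b] v v' True st by auto
    then have "v' = v"
      using free[of b] True by (auto simp: billiard_law_def)
    moreover have "f b + (c - b) *\<^sub>R v = f a + (c - a) *\<^sub>R v"
      unfolding v(1) by (simp add: algebra_simps)
    ultimately show ?thesis
      using v v' by (auto simp: P_def)
  qed (use P le in \<open>auto simp: P_def\<close>)
  have "P s t"
    using less_imp_le[OF \<open>s < t\<close>]
  proof (induction rule: Bolzano)
    case (local x)
    obtain d1 where d1: "d1 > 0" "\<And>y. x < y \<Longrightarrow> y < x + d1 \<Longrightarrow> P x y"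
    proof (cases "x < t")
      case True
      then obtain w where w: "departs f x w"
        using path_departs[of x] local st by auto
      then obtain b where "b > x" "\<And>y. x < y \<Longrightarrow> y < b \<Longrightarrow> f y = f x + (y - x) *\<^sub>R w \<and> arrives f y w \<and> departs f y w"
        by (rule departs_nearby) blast
      then show ?thesis
        using that[of "b - x"] w by (auto simp: P_def)
    qed (use that[of 1] in \<open>auto simp: P_def\<close>)
    obtain d2 where d2: "d2 > 0" "\<And>y. x - d2 < y \<Longrightarrow> y < x \<Longrightarrow> P y x"
    proof (cases "s < x")
      case True
      then obtain w where w: "arrives f x w"
        using path_arrives[of x] local st by auto
      then obtain b where b: "b < x" "\<And>y. b < y \<Longrightarrow> y < x \<Longrightarrow> f y = f x + (y - x) *\<^sub>R w \<and> arrives f y w \<and> departs f y w"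
        by (rule arrives_nearby) blast
      have "P y x" if "b < y" "y < x" for y
        using b(2)[OF that] w by (auto simp: P_def algebra_simps intro!: exI[of _ w])
      then show ?thesis
        using that[of "x - b"] b(1) by auto
    qed (use that[of 1] in \<open>auto simp: P_def\<close>)
    have "P a b" if "a \<le> x \<and> x \<le> b \<and> b - a < min d1 d2" for a b
      using that d1(2)[of b] d2(2)[of a] trans[of a x b] by (cases "a = x"; cases "b = x") (auto simp: P_def)
    then show ?case
      using d1(1) d2(1) by (intro exI[of _ "min d1 d2"]) auto
  qed (rule trans)
  then show ?thesis
    using st w departs_unique unfolding P_def by fastforce
qed

text \<open>A path leaving along the edge that it has struck would slide on it immediately afterwards.\<close>

lemma transverse_departure:
  assumes t: "t \<in> {0..<1}" and w: "departs f t w" and i: "i \<in> labels vs" "f t \<in> edge vs i"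
  shows "reflect 0 (dir i) w \<noteq> w"
proof
  assume par: "reflect 0 (dir i) w = w"
  obtain b where b: "b > t"
      "\<And>y. t < y \<Longrightarrow> y < b \<Longrightarrow> f y = f t + (y - t) *\<^sub>R w \<and> arrives f y w \<and> departs f y w"
    using w by (rule departs_nearby) blast
  obtain y where y: "t < y" "y < min b 1"
    using dense[of t "min b 1"] b(1) t by auto
  have y1: "y \<in> {0<..<1}"
    using y t by auto
  have fy: "f y = f t + (y - t) *\<^sub>R w" "arrives f y w" "departs f y w"
    using b(2)[of y] y by auto
  have "f t + (y - t) *\<^sub>R w \<in> edge vs i"
    using edge_absorbs_parallel[OF i path_nonvertex[of t], of "(y - t) *\<^sub>R w"] par t y1 fy(1)
      path_hull[of y] by (simp add: reflect_0_scaleR)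
  then show False
    using no_grazing[OF y1 i(1) _ fy(2,3)] fy(1) by simp
qed

lemma struck_singleton:
  assumes "t \<in> {0..1}" "struck vs (f t) \<noteq> {}"
  shows "\<exists>i. i \<in> labels vs \<and> f t \<in> edge vs i \<and> struck vs (f t) = {i}"
proof -
  obtain i where i: "i \<in> labels vs" "f t \<in> edge vs i"
    using assms(2) by (auto simp: struck_def)
  then have "struck vs (f t) = {i}"
    using edge_unique[OF path_nonvertex[OF assms(1)]] by (auto simp: struck_def)
  with i show ?thesis
    by blast
qed

end

context periodic_billiard begin

text \<open>The strikes in one period are numbered from 0 to \<open>k - 1\<close>, and the number \<open>k\<close> is the return to the
  starting point at time 1. In the reversed type the starting point still comes first, so the entry
  \<open>n\<close> is the edge of strike \<open>k - n\<close>.\<close>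

lemma periodic_itinerary:
  assumes start: "struck vs (f 0) \<noteq> {}"
  obtains k t \<sigma> F D where "k > 0" "itinerary \<sigma> F D"
    "\<And>n. \<sigma> (n + k) = \<sigma> n" "\<And>n. F (n + k) = F n" "\<And>n. D (n + k) = D n" "\<And>n. norm (D n) = 1"
    "\<And>n. n < k \<Longrightarrow> f (t n) = F n \<and> departs f (t n) (c *\<^sub>R D n)"
    "t 0 = 0" "\<And>n. 0 < n \<Longrightarrow> n < k \<Longrightarrow> 0 < t n \<and> t n < 1"
    "comb_type vs f = map (\<lambda>n. {\<sigma> n}) [0..<k]"
    "comb_type vs (reversepath f) = map (\<lambda>n. {\<sigma> (k - n)}) [0..<k]"
proof -
  define A where "A = {t \<in> {0..<1}. struck vs (f t) \<noteq> {}}"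
  have fin: "finite A"
    by (rule finite_subset[OF _ finite_strikes]) (auto simp: A_def)
  have "0 \<in> A"
    using start by (simp add: A_def)
  define k where "k = card A"
  have k: "k > 0"
    using fin \<open>0 \<in> A\<close> by (auto simp: k_def card_gt_0_iff)
  let ?L = "sorted_list_of_set A"
  have L: "length ?L = k" "set ?L = A" "sorted_wrt (<) ?L"
    using fin by (auto simp: k_def)
  define t where "t n = (if n < k then ?L ! n else 1)" for n
  have tk: "t k = 1"
    by (simp add: t_def)
  have tA: "t n \<in> A" if "n < k" for n
    using L that nth_mem[of n ?L] by (simp add: t_def)
  have t_range: "0 \<le> t n \<and> t n < 1" if "n < k" for n
    using tA[OF that] by (simp add: A_def)
  have t_less: "t m < t n" if "m < n" "n \<le> k" for m n
  proof (cases "n < k")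
    case True
    then show ?thesis
      using sorted_wrt_nth_less[OF L(3), of m n] L(1) that by (simp add: t_def)
  next
    case False
    then show ?thesis
      using that t_range[of m] tk by simp
  qed
  have t_less_iff: "t m < t n \<longleftrightarrow> m < n" if "m \<le> k" "n \<le> k" for m n
    using t_less[of m n] t_less[of n m] that by (cases m n rule: linorder_cases) auto
  have A_t: "\<exists>n<k. u = t n" if "u \<in> A" for u
    using L(1,2) that in_set_conv_nth[of u ?L] by (auto simp: t_def)
  have t0: "t 0 = 0"
  proof -
    obtain n where n: "n < k" "0 = t n"
      using A_t[OF \<open>0 \<in> A\<close>] by blast
    then show ?thesis
      using t_less[of 0 n] t_range[of 0] k by (cases "n = 0") auto
  qed
  have free: "struck vs (f u) = {}" if "n < k" "t n < u" "u < t (Suc n)" for n u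
  proof (rule ccontr)
    assume "struck vs (f u) \<noteq> {}"
    moreover have "t (Suc n) \<le> 1"
      using t_range[of "Suc n"] tk that(1) by (cases "Suc n = k") auto
    ultimately have "u \<in> A"
      using that t_range[of n] by (simp add: A_def)
    then obtain m where "m < k" "u = t m"
      using A_t by blast
    then show False
      using t_less_iff[of n m] t_less_iff[of m "Suc n"] that by simp
  qed
  have "\<exists>w. norm w = c \<and> departs f (t n) w" if "n < k" for n
    using path_departs[of "t n"] t_range[OF that] by simp
  then obtain W where W: "\<And>n. n < k \<Longrightarrow> norm (W n) = c \<and> departs f (t n) (W n)"
    by metis
  have "\<exists>i. i \<in> labels vs \<and> f (t n) \<in> edge vs i \<and> struck vs (f (t n)) = {i}" if "n < k" for n
    using struck_singleton[of "t n"] tA[OF that] by (simp add: A_def)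
  then obtain e where e: "\<And>n. n < k \<Longrightarrow> e n \<in> labels vs \<and> f (t n) \<in> edge vs (e n) \<and> struck vs (f (t n)) = {e n}"
    by metis
  define \<sigma> where "\<sigma> n = e (n mod k)" for n
  define F where "F n = f (t (n mod k))" for n
  define D where "D n = (1 / c) *\<^sub>R W (n mod k)" for n
  have it: "itinerary \<sigma> F D"
    unfolding itinerary_def
  proof (intro allI conjI)
    fix n
    define m where "m = n mod k"
    have m: "m < k"
      using k by (simp add: m_def)
    have tm: "t m \<in> {0..<1}"
      using t_range[OF m] by simp
    show "\<sigma> n \<in> labels vs" "F n \<in> edge vs (\<sigma> n)"
      using e[OF m] by (auto simp: \<sigma>_def F_def m_def)
    show "F n \<notin> set vs"
      using path_nonvertex tm by (simp add: F_def m_def)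
    show "reflect 0 (dir (\<sigma> n)) (D n) \<noteq> D n"
      using transverse_departure[OF tm] W[OF m] e[OF m] c_pos
      by (auto simp: \<sigma>_def D_def m_def reflect_0_scaleR)
    have "t (Suc m) \<le> 1"
      using t_range[of "Suc m"] tk m by (cases "Suc m = k") auto
    then have seg: "f (t (Suc m)) = f (t m) + (t (Suc m) - t m) *\<^sub>R W m \<and> arrives f (t (Suc m)) (W m)"
      using linear_between_strikes[of "t m" "t (Suc m)" "W m"] t_less[of m "Suc m"] tm free[OF m] W[OF m] m
      by auto
    have next': "F (Suc n) = f (t (Suc m)) \<and> billiard_law vs (F (Suc n)) (W m) (W (Suc n mod k))"
    proof (cases "Suc m = k")
      case True
      then have "Suc n mod k = 0"
        by (simp add: m_def mod_Suc)
      then show ?thesis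
        using True seg path_closed path_closing_law W[of 0] k t0 tk by (simp add: F_def)
    next
      case False
      then have Sm: "Suc n mod k = Suc m" "Suc m < k"
        using m by (auto simp: m_def mod_Suc)
      then have "t (Suc m) \<in> {0<..<1}"
        using t_range[OF Sm(2)] t_less[of m "Suc m"] tm by auto
      then show ?thesis
        using path_law[of "t (Suc m)" "W m" "W (Suc m)"] seg W[OF Sm(2)] Sm by (simp add: F_def)
    qed
    show "\<exists>\<tau>>0. F (Suc n) = F n + \<tau> *\<^sub>R D n"
      using next' seg t_less[of m "Suc m"] m c_pos
      by (intro exI[of _ "(t (Suc m) - t m) * c"]) (simp add: D_def F_def m_def)
    have "W (Suc n mod k) = reflect 0 (dir (\<sigma> (Suc n))) (W m)"
    proof (rule law_at_strike[OF next'[THEN conjunct2]])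
      show "\<sigma> (Suc n) \<in> labels vs" "F (Suc n) \<in> edge vs (\<sigma> (Suc n))"
        using e[of "Suc n mod k"] k by (simp_all add: \<sigma>_def F_def)
    qed
    then show "D (Suc n) = reflect 0 (dir (\<sigma> (Suc n))) (D n)"
      by (simp add: D_def m_def reflect_0_scaleR)
  qed
  have type: "comb_type vs f = map (\<lambda>n. {\<sigma> n}) [0..<k]"
    unfolding comb_type_def A_def[symmetric]
  proof (rule nth_equalityI)
    fix n
    assume "n < length (map (\<lambda>t. struck vs (f t)) ?L)"
    then have n: "n < k"
      using L(1) by simp
    then have "struck vs (f (?L ! n)) = {\<sigma> n}"
      using e[of n] by (simp add: \<sigma>_def t_def)
    then show "map (\<lambda>t. struck vs (f t)) ?L ! n = map (\<lambda>n. {\<sigma> n}) [0..<k] ! n"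
      using n L(1) by simp
  qed (use L(1) in simp)
  have rev_type: "comb_type vs (reversepath f) = map (\<lambda>n. {\<sigma> (k - n)}) [0..<k]"
  proof -
    let ?M = "map (\<lambda>n. 1 - t (k - n)) [0..<k]"
    have strike: "struck vs (f (t m)) = {\<sigma> m}" if "0 < m" "m \<le> k" for m
    proof (cases "m = k")
      case True
      then show ?thesis
        using e[of 0] k path_closed t0 tk by (simp add: \<sigma>_def)
    next
      case False
      then show ?thesis
        using e[of m] that by (simp add: \<sigma>_def)
    qed
    have set_M: "set ?M = {u \<in> {0..<1}. struck vs (reversepath f u) \<noteq> {}}" (is "_ = ?B")
    proof
      show "set ?M \<subseteq> ?B"
      proof
        fix u
        assume "u \<in> set ?M"
        then obtain n where n: "n < k" "u = 1 - t (k - n)"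
          by auto
        then show "u \<in> ?B"
          using strike[of "k - n"] t_less[of 0 "k - n"] t_range[of "k - n"] t0 tk
          by (cases "n = 0") (auto simp: reversepath_def)
      qed
      show "?B \<subseteq> set ?M"
      proof
        fix u
        assume u: "u \<in> ?B"
        show "u \<in> set ?M"
        proof (cases "u = 0")
          case True
          then show ?thesis
            using tk k by (auto simp: image_iff intro!: bexI[of _ 0])
        next
          case False
          then have "1 - u \<in> A"
            using u by (auto simp: A_def reversepath_def)
          then obtain m where m: "m < k" "1 - u = t m"
            using A_t by blast
          then have "m \<noteq> 0"
            using u t0 by auto
          then show ?thesis
            using m by (auto simp: image_iff intro!: bexI[of _ "k - m"])
        qed
      qed
    qed
    have "sorted_wrt (<) ?M"
      by (auto simp: sorted_wrt_iff_nth_less intro: t_less)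
    then have "sorted ?M" "distinct ?M"
      by (simp_all only: strict_sorted_iff)
    then have M: "sorted_list_of_set ?B = ?M"
      unfolding set_M[symmetric] by (rule sorted_list_of_set.idem_if_sorted_distinct)
    have "struck vs (reversepath f (1 - t (k - n))) = {\<sigma> (k - n)}" if "n < k" for n
      using strike[of "k - n"] that by (simp add: reversepath_def)
    then show ?thesis
      unfolding comb_type_def M by simp
  qed
  show ?thesis
  proof (rule that[of k \<sigma> F D t])
    show "k > 0" "itinerary \<sigma> F D" "t 0 = 0" "comb_type vs f = map (\<lambda>n. {\<sigma> n}) [0..<k]"
      "comb_type vs (reversepath f) = map (\<lambda>n. {\<sigma> (k - n)}) [0..<k]"
      by fact+
    show "norm (D n) = 1" for n
      using W[of "n mod k"] k c_pos by (simp add: D_def)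
    show "f (t n) = F n \<and> departs f (t n) (c *\<^sub>R D n)" if "n < k" for n
      using W[OF that] that c_pos by (simp add: F_def D_def)
    show "0 < t n \<and> t n < 1" if "0 < n" "n < k" for n
      using t_less[of 0 n] t_range[of n] that t0 by simp
  qed (simp_all add: \<sigma>_def F_def D_def)
qed

end

section \<open>Unfolding, and the number of strikes in a period\<close>

lemma reflect_shift: "reflect a b (z + v) = reflect a b z + reflect 0 (b - a) v"
proof -
  have "reflect a b (z + v) = a + reflect 0 (b - a) ((z - a) + v)"
    by (simp add: reflect_as_linear[of a b] algebra_simps)
  then show ?thesis
    by (simp only: reflect_0_add reflect_as_linear[of a b z]) simp
qed

context convex_polygon
begin

definition unfold_word :: "nat list \<Rightarrow> complex \<Rightarrow> complex" where
  "unfold_word = foldr (\<lambda>i. reflect (edge_start vs i) (edge_end vs i))"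

text \<open>Reflecting the polygon instead of the path makes the path straight: the image of the last
  point under the reflections in the edges struck lies on the initial ray.\<close>

lemma unfold_itinerary:
  assumes "itinerary \<sigma> F D"
  shows "\<exists>l. 0 \<le> l \<and> (n > 0 \<longrightarrow> 0 < l) \<and>
    unfold_word (map \<sigma> [Suc m..<Suc (m + n)]) (F (m + n)) = F m + l *\<^sub>R D m"
proof (induction n arbitrary: m)
  case (Suc n)
  let ?i = "\<sigma> (Suc m)"
  obtain l where l: "0 \<le> l"
    "unfold_word (map \<sigma> [Suc (Suc m)..<Suc (Suc m + n)]) (F (Suc m + n)) = F (Suc m) + l *\<^sub>R D (Suc m)"
    using Suc.IH by blast
  obtain \<tau> where \<tau>: "\<tau> > 0" "F (Suc m) = F m + \<tau> *\<^sub>R D m"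
    using itinerary_step[OF assms] by blast
  have i: "?i \<in> labels vs" "F (Suc m) \<in> edge vs ?i"
    using itinerary_label[OF assms] itinerary_edge[OF assms] by auto
  have "reflect 0 (dir ?i) (F (Suc m) - edge_start vs ?i) = F (Suc m) - edge_start vs ?i"
    using reflect_edge_diff[OF i] by (simp add: edge_def)
  moreover have "reflect 0 (dir ?i) (D (Suc m)) = D m"
    using itinerary_turn[OF assms, of m] reflect_0_involution dir_nonzero[OF i(1)] by metis
  ultimately have "reflect (edge_start vs ?i) (edge_end vs ?i) (F (Suc m) + l *\<^sub>R D (Suc m)) =
      F (Suc m) + l *\<^sub>R D m"
    by (simp add: reflect_shift reflect_as_linear[of _ _ "F (Suc m)"] reflect_0_scaleR dir_def)
  also have "\<dots> = F m + (\<tau> + l) *\<^sub>R D m"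
    using \<tau> by (simp add: algebra_simps)
  finally have "reflect (edge_start vs ?i) (edge_end vs ?i) (F (Suc m) + l *\<^sub>R D (Suc m)) =
      F m + (\<tau> + l) *\<^sub>R D m" .
  moreover have "[Suc m..<Suc (m + Suc n)] = Suc m # [Suc (Suc m)..<Suc (Suc m + n)]"
    by (simp add: upt_conv_Cons del: upt_Suc)
  ultimately have "unfold_word (map \<sigma> [Suc m..<Suc (m + Suc n)]) (F (m + Suc n)) = F m + (\<tau> + l) *\<^sub>R D m"
    using l(2) by (simp add: unfold_word_def del: upt_Suc)
  then show ?case
    using l(1) \<tau>(1) by (intro exI[of _ "\<tau> + l"]) auto
qed (auto simp: unfold_word_def)

text \<open>The reflections depend only on the word and the path returns to its starting point, so the end
  of the straightened path, and with it the direction, is a function of the word and that point.\<close>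

lemma direction_from_word:
  assumes it: "itinerary \<sigma> F D" and k: "k > 0" "F k = F 0" and D: "norm (D 0) = 1"
  shows "D 0 = sgn (unfold_word (map \<sigma> [1..<Suc k]) (F 0) - F 0)"
proof -
  obtain l where l: "l > 0" "unfold_word (map \<sigma> [Suc 0..<Suc (0 + k)]) (F (0 + k)) = F 0 + l *\<^sub>R D 0"
    using unfold_itinerary[OF it, of k 0] k by blast
  then have "unfold_word (map \<sigma> [1..<Suc k]) (F 0) - F 0 = l *\<^sub>R D 0"
    using k by (simp del: upt_Suc)
  then show ?thesis
    using l(1) D by (simp add: sgn_div_norm del: upt_Suc)
qed

text \<open>There are only so many combinations of an edge, a parity, a direction and a small cell, so a long
  itinerary with a companion must return close to itself, hence close up.\<close>

lemma early_return:
  assumes F: "itinerary \<sigma> F D" and G: "itinerary \<sigma> G D" and norm: "\<And>n. norm (D n) = 1"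
    and w: "\<bar>cross (G 0 - F 0) (D 0)\<bar> \<ge> w"
    and dirs: "finite \<D>" "card \<D> \<le> M" "\<And>n. D n \<in> \<D>"
    and cells: "finite C" "convex hull set vs \<subseteq> (\<Union>z\<in>C. ball z (w / 2))"
    and k: "k > length vs * (2 * (M * card C))"
  shows "\<exists>i j. i < j \<and> j < k \<and>
    (\<forall>n. \<sigma> (j + n) = \<sigma> (i + n) \<and> D (j + n) = D (i + n) \<and> F (j + n) = F (i + n))"
proof -
  have "\<exists>z\<in>C. F n \<in> ball z (w / 2)" for n
    using itinerary_hull[OF F, of n] cells(2) by blast
  then obtain z where z: "\<And>n. z n \<in> C" "\<And>n. F n \<in> ball (z n) (w / 2)"
    by metis
  define h where "h n = (\<sigma> n, even n, D n, z n)" for n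
  let ?K = "labels vs \<times> (UNIV :: bool set) \<times> \<D> \<times> C"
  have fin: "finite ?K"
    using dirs cells by (simp add: labels_def)
  have "h ` {..<k} \<subseteq> ?K"
    using itinerary_label[OF F] dirs z by (auto simp: h_def)
  moreover have "card ?K < k"
  proof -
    have "card ?K = length vs * (2 * (card \<D> * card C))"
      by (simp add: card_cartesian_product labels_def)
    also have "\<dots> \<le> length vs * (2 * (M * card C))"
      using dirs(2) by (intro mult_le_mono) auto
    finally show ?thesis
      using k by simp
  qed
  ultimately have "\<not> inj_on h {..<k}"
    using card_inj_on_le[OF _ _ fin, of h "{..<k}"] by auto
  then obtain i j where ij: "i < j" "j < k" "h i = h j"
    unfolding inj_on_def by (metis lessThan_iff linorder_neqE_nat)
  have "dist (F i) (F j) < w"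
    using z(2)[of i] z(2)[of j] ij(3) dist_triangle_half_r[of "z i" "F i" w "F j"] by (simp add: h_def)
  then have "\<forall>n. \<sigma> (j + n) = \<sigma> (i + n) \<and> D (j + n) = D (i + n) \<and> F (j + n) = F (i + n)"
    using close_return[OF F G norm w ij(1)] ij(3) by (simp add: h_def)
  then show ?thesis
    using ij by blast
qed

end

section \<open>Triangles are convex polygons\<close>

lemma triangle_labels: "labels [p, r, q] = {1, 2, 3}"
  by (auto simp: labels_def)

lemma triangle_edges:
  "edge [p, r, q] 1 = closed_segment p r"
  "edge [p, r, q] 2 = closed_segment r q"
  "edge [p, r, q] 3 = closed_segment q p"
  by (auto simp: edge_def edge_start_def edge_end_def)

text \<open>The faces of a simplex are the hulls of sets of its vertices, and two such hulls meet in the hull of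
  the common vertices.\<close>

lemma triangle_convex_polygon:
  assumes "\<not> collinear {p, q, r}"
  shows "convex_polygon [p, r, q]"
proof -
  have ne: "p \<noteq> q" "p \<noteq> r" "q \<noteq> r" and ind: "\<not> affine_dependent {p, r, q}"
    using assms collinear_3_eq_affine_dependent[of p q r] by (auto simp: insert_commute)
  have seg_Int: "closed_segment a b \<inter> closed_segment b c = {b}"
    if "{a, b, c} \<subseteq> {p, r, q}" "{p, r, q} \<subseteq> {a, b, c}" "a \<noteq> b" "a \<noteq> c" "b \<noteq> c" for a b c
  proof -
    have "{a, b} \<union> {b, c} = {p, r, q}"
      using that(1,2) by auto
    then have "convex hull ({a, b} \<inter> {b, c}) = convex hull {a, b} \<inter> convex hull {b, c}"
      using ind by (intro convex_hull_Int) simp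
    moreover have "{a, b} \<inter> {b, c} = {b}"
      using that by auto
    ultimately show ?thesis
      by (simp add: segment_convex_hull)
  qed
  show ?thesis
  proof
    fix i
    assume i: "i \<in> labels [p, r, q]"
    then have "i = 1 \<or> i = 2 \<or> i = 3"
      by (simp add: triangle_labels)
    then obtain a b where ab: "{a, b} \<subseteq> {p, r, q}" "edge [p, r, q] i = convex hull {a, b}"
      by (elim disjE) (auto simp: triangle_edges segment_convex_hull simp del: One_nat_def)
    have "convex hull {a, b} face_of convex hull {p, r, q}"
      unfolding face_of_convex_hull_affine_independent[OF ind] using ab(1) by blast
    then show "edge [p, r, q] i face_of convex hull set [p, r, q]"
      using ab(2) by simp
    show "edge_start [p, r, q] i \<noteq> edge_end [p, r, q] i"
      using \<open>i = 1 \<or> i = 2 \<or> i = 3\<close> ne by (auto simp: edge_start_def edge_end_def)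
  next
    fix i j
    assume ij: "i \<in> labels [p, r, q]" "j \<in> labels [p, r, q]" "i \<noteq> j"
    have s: "closed_segment p r \<inter> closed_segment r q = {r}" "closed_segment r q \<inter> closed_segment q p = {q}"
      "closed_segment q p \<inter> closed_segment p r = {p}"
      by (rule seg_Int; use ne in blast)+
    show "edge [p, r, q] i \<inter> edge [p, r, q] j \<subseteq> set [p, r, q]"
      using ij unfolding triangle_labels
      by (elim insertE emptyE) (simp_all only: triangle_edges s Int_commute[of "closed_segment r q" "closed_segment p r"]
        Int_commute[of "closed_segment q p" "closed_segment r q"] Int_commute[of "closed_segment p r" "closed_segment q p"], simp_all)
  next
    fix v
    assume "v \<in> set [p, r, q]"
    then show "v extreme_point_of convex hull set [p, r, q]"
      using extreme_point_of_convex_hull_affine_independent[OF ind] by simp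
  qed
qed

section \<open>The mirror symmetry of an isosceles triangle\<close>

lemma reflect_0_uminus_axis: "reflect 0 (- d) v = reflect 0 d v"
  by (simp add: reflect_def)

text \<open>Conjugating a reflection by an isometry gives the reflection in the image of the axis.\<close>

lemma reflect_0_conjugate:
  assumes "d \<noteq> 0" "a \<noteq> 0"
  shows "reflect 0 (reflect 0 d a) (reflect 0 d v) = reflect 0 d (reflect 0 a v)"
  using assms by (simp add: reflect_def field_simps)

lemma periodic_mod:
  fixes g :: "nat \<Rightarrow> 'b"
  assumes "\<And>n. g (n + k) = g n"
  shows "g (n mod k) = g n"
proof -
  have "g (m + l * k) = g m" for m l
  proof (induction l)
    case (Suc l)
    then show ?case
      using assms[of "m + l * k"] by (simp add: add_ac)
  qed simp
  from this[of "n mod k" "n div k"] show ?thesis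
    by simp
qed

locale isosceles_triangle =
  fixes p q r :: complex
  assumes nondegenerate: "\<not> collinear {p, q, r}"
    and isosceles: "dist p r = dist q r"

sublocale isosceles_triangle \<subseteq> convex_polygon "[p, r, q]"
  by (rule triangle_convex_polygon) (rule nondegenerate)

context isosceles_triangle
begin

abbreviation "T \<equiv> [p, r, q]"
abbreviation "centre \<equiv> midpoint p q"
abbreviation "base \<equiv> q - p"

definition mirror :: "complex \<Rightarrow> complex" where
  "mirror = reflect centre r"

lemma base_nonzero: "base \<noteq> 0"
  using nondegenerate by (auto simp: insert_commute)

lemma apex_not_centre: "r \<noteq> centre"
  using nondegenerate collinear_midpoint[of p q] by (auto simp: insert_commute)

text \<open>The axis of symmetry is perpendicular to the base.\<close>

lemma equidistant:
  assumes "dist z p = dist z q"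
  shows "\<exists>s::real. z - centre = (\<i> * s) * base"
proof -
  define y where "y = (z - centre) / base"
  have z: "z = centre + y * base"
    using base_nonzero by (simp add: y_def)
  have "z - p = (y + 1 / 2) * base" "z - q = (y - 1 / 2) * base"
    unfolding z by (simp_all add: midpoint_def scaleR_conv_of_real field_simps)
  then have "cmod (y + 1 / 2) = cmod (y - 1 / 2)"
    using assms base_nonzero by (simp add: dist_norm norm_mult)
  then have "(cmod (y + 1 / 2))\<^sup>2 = (cmod (y - 1 / 2))\<^sup>2"
    by simp
  then have "Re y = 0"
    unfolding cmod_power2 by (simp add: power2_eq_square algebra_simps)
  then have "y = \<i> * Im y"
    by (simp add: complex_eq_iff)
  then show ?thesis
    using z by (metis add_diff_cancel_left')
qed

text \<open>The mirror axis is perpendicular to the base, so the mirror acts on vectors as minus the reflection in the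
  base. This form does not mention the apex, and makes the interplay with the reversal of time visible.\<close>

lemma mirror_eq: "mirror z = centre - reflect 0 base (z - centre)"
proof -
  obtain s :: real where s: "r - centre = (\<i> * s) * base"
    using equidistant[of r] isosceles by (auto simp: dist_commute)
  then have "s \<noteq> 0"
    using apex_not_centre by auto
  then show ?thesis
    using base_nonzero unfolding mirror_def reflect_def s by (simp add: field_simps)
qed

lemma mirror_shift: "mirror (z + v) = mirror z - reflect 0 base v"
  by (simp add: mirror_eq reflect_0_add add_diff_eq[symmetric] diff_diff_eq add.commute[of z])

lemma mirror_diff: "mirror y - mirror z = - reflect 0 base (y - z)"
  using mirror_shift[of z "y - z"] by simp

lemma mirror_mirror: "mirror (mirror z) = z"
  using mirror_diff[of "mirror z" centre] base_nonzero
  by (simp add: mirror_eq[of z] mirror_eq[of centre] reflect_0_minus reflect_0_involution)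
     (simp add: mirror_eq reflect_0_minus reflect_0_involution)

lemma dist_mirror: "dist (mirror y) (mirror z) = dist y z"
  by (simp add: dist_norm mirror_diff norm_reflect_0[OF base_nonzero])

lemma reflect_base: "reflect 0 base (s *\<^sub>R base) = s *\<^sub>R base"
  using base_nonzero reflect_0_eq_self_iff by blast

lemma mirror_base_end: "mirror p = q"
proof -
  have "p - centre = (- 1 / 2) *\<^sub>R base"
    by (simp add: midpoint_def scaleR_conv_of_real field_simps)
  then have "mirror p = centre - (- 1 / 2) *\<^sub>R base"
    using reflect_base[of "- 1 / 2"] by (simp only: mirror_eq)
  then show ?thesis
    by (simp add: midpoint_def scaleR_conv_of_real field_simps)
qed

lemma mirror_base_start: "mirror q = p"
  using mirror_mirror[of p] by (simp add: mirror_base_end)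

lemma mirror_equidistant:
  assumes "dist z p = dist z q"
  shows "mirror z = z"
proof -
  obtain s :: real where s: "z - centre = (\<i> * s) * base"
    using equidistant assms by blast
  then have "reflect 0 base (z - centre) = - (z - centre)"
    using base_nonzero by (simp add: reflect_def)
  then show ?thesis
    by (simp add: mirror_eq)
qed

lemma mirror_apex: "mirror r = r"
  using mirror_equidistant[of r] isosceles by (simp add: dist_commute)

lemma mirror_in_segment:
  assumes "z \<in> closed_segment a b"
  shows "mirror z \<in> closed_segment (mirror a) (mirror b)"
proof -
  obtain u where u: "z = (1 - u) *\<^sub>R a + u *\<^sub>R b" "0 \<le> u" "u \<le> 1"
    using assms by (auto simp: closed_segment_def)
  have z: "z = a + u *\<^sub>R (b - a)"
    unfolding u(1) by (simp add: algebra_simps)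
  have "mirror z = mirror a + u *\<^sub>R (mirror b - mirror a)"
    unfolding z mirror_shift mirror_diff[of b a] by (simp add: reflect_0_scaleR)
  also have "\<dots> = (1 - u) *\<^sub>R mirror a + u *\<^sub>R mirror b"
    by (simp add: algebra_simps)
  finally show ?thesis
    using u(2,3) by (auto simp: closed_segment_def)
qed

lemma mirror_in_hull:
  assumes "z \<in> convex hull {p, r, q}"
  shows "mirror z \<in> convex hull {p, r, q}"
proof -
  obtain u v w where uvw: "0 \<le> u" "0 \<le> v" "0 \<le> w" "u + v + w = 1" and z: "z = u *\<^sub>R p + v *\<^sub>R r + w *\<^sub>R q"
    using assms unfolding convex_hull_3 by blast
  have u: "u = 1 - v - w"
    using uvw(4) by simp
  have "z = p + v *\<^sub>R (r - p) + w *\<^sub>R (q - p)"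
    unfolding z u by (simp add: algebra_simps)
  then have "mirror z = mirror p + v *\<^sub>R (mirror r - mirror p) + w *\<^sub>R (mirror q - mirror p)"
    by (simp only: mirror_shift mirror_diff reflect_0_scaleR) simp
  also have "\<dots> = w *\<^sub>R p + v *\<^sub>R r + u *\<^sub>R q"
    unfolding u mirror_apex mirror_base_end mirror_base_start by (simp add: algebra_simps)
  finally show ?thesis
    using uvw unfolding convex_hull_3 by (intro CollectI exI[of _ w] exI[of _ v] exI[of _ u]) simp
qed

definition swap :: "nat \<Rightarrow> nat" where
  "swap i = (if i = 1 then 2 else if i = 2 then 1 else i)"

lemma swap_swap: "swap (swap i) = i"
  by (simp add: swap_def)

lemma swap_label: "swap i \<in> labels T \<longleftrightarrow> i \<in> labels T"
  by (auto simp: swap_def labels_def)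

lemma mirror_in_edge:
  assumes "i \<in> labels T" "z \<in> edge T i"
  shows "mirror z \<in> edge T (swap i)"
proof -
  have "i = 1 \<or> i = 2 \<or> i = 3"
    using assms(1) by (simp add: triangle_labels)
  then show ?thesis
    using assms(2) mirror_in_segment[of z p r] mirror_in_segment[of z r q] mirror_in_segment[of z q p]
    by (elim disjE) (simp_all add: swap_def triangle_edges mirror_apex mirror_base_end mirror_base_start
      closed_segment_commute del: One_nat_def)
qed

text \<open>One inclusion gives the other, since the mirror and the exchange of the sides are involutions.\<close>

lemma struck_mirror: "struck T (mirror z) = swap ` struck T z"
proof -
  have "swap i \<in> struck T (mirror z)" if "i \<in> struck T z" for z i
    using that mirror_in_edge swap_label by (auto simp: struck_def)
  from this[of _ z] this[of _ "mirror z"] show ?thesis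
    by (metis (no_types, lifting) image_iff mirror_mirror subsetI subset_antisym image_subsetI swap_swap)
qed

lemma reflect_swap:
  assumes "i \<in> labels T"
  shows "reflect 0 (dir (swap i)) (reflect 0 base v) = reflect 0 base (reflect 0 (dir i) v)"
proof -
  have dirs: "dir 1 = r - p" "dir 2 = q - r" "dir 3 = - base"
    by (simp_all add: dir_def edge_start_def edge_end_def)
  have "reflect 0 base (r - p) = q - r" "reflect 0 base (q - r) = r - p"
    using mirror_diff[of r p] mirror_diff[of q r]
    unfolding mirror_apex mirror_base_end mirror_base_start by (simp_all add: algebra_simps)
  moreover have "reflect 0 base (- base) = - base"
    using reflect_base[of "- 1"] by simp
  moreover have "i = 1 \<or> i = 2 \<or> i = 3"
    using assms by (simp add: triangle_labels)
  ultimately have "dir (swap i) = reflect 0 base (dir i)"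
    using dirs by (elim disjE) (simp_all add: swap_def del: One_nat_def)
  then show ?thesis
    using reflect_0_conjugate[OF base_nonzero dir_nonzero[OF assms]] by simp
qed

text \<open>Folding along the axis cannot distinguish a point from its mirror image.\<close>

lemma fold_map_mirror: "fold_map p q r (mirror z) = fold_map p q r z"
proof -
  have "dist (mirror z) p = dist z q" "dist (mirror z) q = dist z p"
    using dist_mirror[of z q] dist_mirror[of z p] by (simp_all add: mirror_base_end mirror_base_start)
  then show ?thesis
    using mirror_mirror[of z] mirror_equidistant[of z]
    by (auto simp: fold_map_def mirror_def[symmetric])
qed

lemma mirror_arrives: "arrives f t v \<Longrightarrow> arrives (mirror \<circ> f) t (- reflect 0 base v)"
  unfolding arrives_def by (erule eventually_mono) (simp add: mirror_shift reflect_0_scaleR)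

lemma mirror_departs: "departs f t v \<Longrightarrow> departs (mirror \<circ> f) t (- reflect 0 base v)"
  unfolding departs_def by (erule eventually_mono) (simp add: mirror_shift reflect_0_scaleR)

text \<open>The mirror conjugates the reflection in an edge to the reflection in the mirrored edge.\<close>

lemma mirror_law:
  assumes "billiard_law T z v w"
  shows "billiard_law T (mirror z) (- reflect 0 base v) (- reflect 0 base w)"
proof -
  have "reflect 0 base w = reflect 0 (dir (swap i)) (reflect 0 base v)" if i: "i \<in> struck T z" for i
  proof -
    have "struck T z \<noteq> {}"
      using i by blast
    then have "w = reflect 0 (dir i) v"
      using assms i by (simp add: billiard_law_def dir_def)
    then show ?thesis
      using reflect_swap[of i v] i by (simp add: struck_def)
  qed
  then show ?thesis
    using assms by (cases "struck T z = {}") (auto simp: billiard_law_def struck_mirror dir_def[symmetric] reflect_0_minus)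
qed

lemma mirror_nonvertex: "z \<notin> set T \<Longrightarrow> mirror z \<notin> set T"
  using mirror_mirror[of z] mirror_apex mirror_base_end mirror_base_start by auto

lemma mirror_periodic_trajectory:
  assumes "periodic_trajectory T f"
  shows "periodic_trajectory T (mirror \<circ> f)"
proof -
  have "norm (- reflect 0 base v) = norm v" for v
    by (simp add: norm_reflect_0[OF base_nonzero])
  note mirror = this mirror_arrives mirror_departs mirror_law
  obtain c where c: "c > 0" and
    mid: "\<And>t. t \<in> {0<..<1} \<Longrightarrow> \<exists>v w. norm v = c \<and> arrives f t v \<and> departs f t w \<and> billiard_law T (f t) v w"
    and closed: "f 1 = f 0"
    and ends: "\<exists>v w. norm v = c \<and> arrives f 1 v \<and> departs f 0 w \<and> billiard_law T (f 0) v w"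
    and img: "f ` {0..1} \<subseteq> convex hull (set T) - set T"
    using assms unfolding periodic_trajectory_def by blast
  have "(mirror \<circ> f) ` {0..1} \<subseteq> convex hull (set T) - set T"
    using img mirror_in_hull mirror_nonvertex by (auto simp: image_subset_iff)
  moreover have "\<exists>v w. norm v = c \<and> arrives (mirror \<circ> f) t v \<and> departs (mirror \<circ> f) t w \<and>
      billiard_law T ((mirror \<circ> f) t) v w" if "t \<in> {0<..<1}" for t
    using mid[OF that] mirror by (metis comp_apply)
  moreover have "\<exists>v w. norm v = c \<and> arrives (mirror \<circ> f) 1 v \<and> departs (mirror \<circ> f) 0 w \<and>
      billiard_law T ((mirror \<circ> f) 0) v w"
    using ends mirror by (metis comp_apply)
  ultimately show ?thesis
    unfolding periodic_trajectory_def using c closed by (metis comp_apply)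
qed

lemma comb_type_mirror: "comb_type T (mirror \<circ> f) = map ((`) swap) (comb_type T f)"
  by (simp add: comb_type_def struck_mirror)

text \<open>Traversed backwards, the mirrored path strikes the mirrored edges of the reversed word, which are the
  edges of the word itself. It sets out in the same direction as the path, because reversal of time
  combined with the mirror is the reflection in the base, and this is the billiard law at the start.\<close>

lemma mirror_companion:
  assumes it: "itinerary \<sigma> F D" and k: "k > 0"
    and per: "\<And>n. \<sigma> (n + k) = \<sigma> n" "\<And>n. F (n + k) = F n" "\<And>n. D (n + k) = D n"
    and start: "\<sigma> 0 = 3" and symm: "\<And>n. n < k \<Longrightarrow> \<sigma> (k - n) = swap (\<sigma> n)"
  shows "itinerary \<sigma> (\<lambda>n. mirror (F (k - n mod k))) D"
proof -
  \<comment> \<open>Induction along the word: running backwards and mirroring together reflect a direction in the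
    base, which exchanges the reflections in the sides 1 and 2.\<close>
  have dir_symm: "m < k \<Longrightarrow> reflect 0 base (D (k - Suc m)) = D m" for m
  proof (induction m)
    case 0
    have "D 0 = D (Suc (k - 1))"
      using per(3)[of 0] k by simp
    also have "\<dots> = reflect 0 (dir (\<sigma> (Suc (k - 1)))) (D (k - 1))"
      by (rule itinerary_turn[OF it])
    also have "\<sigma> (Suc (k - 1)) = 3"
      using per(1)[of 0] k start by simp
    also have "dir 3 = - base"
      by (simp add: dir_def edge_start_def edge_end_def)
    also have "reflect 0 (- base) (D (k - 1)) = reflect 0 base (D (k - 1))"
      by (rule reflect_0_uminus_axis)
    finally show ?case
      by simp
  next
    case (Suc m)
    let ?j = "k - Suc (Suc m)"
    have j: "k - Suc m = Suc ?j"
      using Suc.prems by simp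
    have \<sigma>: "\<sigma> (Suc ?j) = swap (\<sigma> (Suc m))"
      using symm[of "Suc m"] Suc.prems j by simp
    have l: "\<sigma> (Suc m) \<in> labels T"
      by (rule itinerary_label[OF it])
    have "D (Suc m) = reflect 0 (dir (\<sigma> (Suc m))) (D m)"
      by (rule itinerary_turn[OF it])
    also have "D m = reflect 0 base (D (Suc ?j))"
      using Suc.IH Suc.prems j by simp
    also have "D (Suc ?j) = reflect 0 (dir (swap (\<sigma> (Suc m)))) (D ?j)"
      using itinerary_turn[OF it, of ?j] \<sigma> by simp
    also have "reflect 0 base \<dots> = reflect 0 (dir (\<sigma> (Suc m))) (reflect 0 base (D ?j))"
      using reflect_swap[of "swap (\<sigma> (Suc m))" "D ?j"] l by (simp add: swap_label swap_swap)
    also have "reflect 0 (dir (\<sigma> (Suc m))) \<dots> = reflect 0 base (D ?j)"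
      using reflect_0_involution[OF dir_nonzero[OF l]] .
    finally show ?case
      by simp
  qed
  \<comment> \<open>The index \<open>k - n mod k\<close> runs from \<open>k\<close> down to 1, then starts again at \<open>k\<close>; it never takes the
    value 0, which stands for the same strike as \<open>k\<close>.\<close>
  show ?thesis
    unfolding itinerary_def
  proof (intro allI conjI)
    fix n
    define m where "m = n mod k"
    have m: "m < k"
      using k by (simp add: m_def)
    have \<sigma>m: "\<sigma> m = \<sigma> n" and Dm: "D m = D n"
      using periodic_mod[of \<sigma> k n, OF per(1)] periodic_mod[of D k n, OF per(3)] by (auto simp: m_def)
    show "\<sigma> n \<in> labels T" "reflect 0 (dir (\<sigma> n)) (D n) \<noteq> D n"
      "D (Suc n) = reflect 0 (dir (\<sigma> (Suc n))) (D n)"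
      using itinerary_label[OF it] itinerary_transverse[OF it] itinerary_turn[OF it] by auto
    have "mirror (F (k - m)) \<in> edge T (swap (\<sigma> (k - m)))"
      using mirror_in_edge itinerary_label[OF it] itinerary_edge[OF it] by blast
    then show "mirror (F (k - n mod k)) \<in> edge T (\<sigma> n)"
      using symm[OF m] \<sigma>m by (simp add: m_def swap_swap)
    show "mirror (F (k - n mod k)) \<notin> set T"
      using mirror_nonvertex itinerary_nonvertex[OF it] by blast
    have next_F: "F (k - Suc n mod k) = F (k - Suc m)"
      using per(2)[of 0] m by (cases "Suc m = k") (auto simp: m_def mod_Suc)
    obtain \<tau> where \<tau>: "\<tau> > 0" "F (Suc (k - Suc m)) = F (k - Suc m) + \<tau> *\<^sub>R D (k - Suc m)"
      by (rule itinerary_step[OF it])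
    have "Suc (k - Suc m) = k - m"
      using m by simp
    then have "mirror (F (k - m)) = mirror (F (k - Suc m)) - \<tau> *\<^sub>R D n"
      using \<tau>(2) dir_symm[OF m] Dm by (simp add: mirror_shift reflect_0_scaleR)
    then show "\<exists>\<tau>>0. mirror (F (k - Suc n mod k)) = mirror (F (k - n mod k)) + \<tau> *\<^sub>R D n"
      using \<tau>(1) next_F by (intro exI[of _ \<tau>]) (simp add: m_def)
  qed
qed

end

section \<open>Rational angles: finitely many directions\<close>

text \<open>A quotient of the form \<open>z / cnj z\<close> has twice the argument of \<open>z\<close>.\<close>

lemma unit_square:
  assumes "z \<noteq> 0"
  shows "z / cnj z = (z / of_real (cmod z))\<^sup>2"
proof -
  have "of_real (cmod z) * of_real (cmod z) = z * cnj z"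
    using complex_norm_square[of z] by (simp only: power2_eq_square of_real_mult)
  then have "(z / of_real (cmod z))\<^sup>2 = z * z / (z * cnj z)"
    by (simp only: power2_eq_square times_divide_times_eq)
  then show ?thesis
    using assms by simp
qed

context isosceles_triangle
begin

text \<open>The quotient \<open>base / cnj base\<close>, which turns complex conjugation into the reflection in the
  base.\<close>

definition rho :: complex where
  "rho = base / cnj base"

lemma rho_unit: "rho * cnj rho = 1"
  using base_nonzero by (simp add: rho_def)

text \<open>In units of the base, the two sides are \<open>\<zeta>\<close> and its conjugate, and \<open>\<zeta>\<close> has the base angle as argument up
  to the orientation of the triangle; so \<open>\<zeta> / cnj \<zeta>\<close> is a rotation by twice the base angle, a root
  of unity.\<close>

lemma side_direction:
  assumes angle: "vangle p q r = of_int a / of_int b * pi" and b: "b \<noteq> 0"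
  obtains \<zeta> where "\<zeta> \<noteq> 0" "r - p = base * \<zeta>" "q - r = base * cnj \<zeta>" "(\<zeta> / cnj \<zeta>) ^ nat \<bar>b\<bar> = 1"
proof -
  obtain s :: real where s: "r - centre = (\<i> * s) * base"
    using equidistant[of r] isosceles by (auto simp: dist_commute)
  \<comment> \<open>The real part is \<open>1 / 2\<close> because the apex lies above the centre of the base.\<close>
  define \<zeta> where "\<zeta> = 1 / 2 + \<i> * of_real s"
  have Re: "Re \<zeta> = 1 / 2"
    by (simp add: \<zeta>_def)
  then have nz: "\<zeta> \<noteq> 0"
    by auto
  have rp: "r - p = base * \<zeta>" "q - r = base * cnj \<zeta>"
    using s by (simp_all add: \<zeta>_def midpoint_def scaleR_conv_of_real field_simps)
  define u where "u = \<zeta> / of_real (cmod \<zeta>)"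
  have u: "cmod u = 1" "Re u = Re \<zeta> / cmod \<zeta>"
    using nz by (simp_all add: u_def norm_divide)
  have "d \<bullet> (d * z) = (cmod d)\<^sup>2 * Re z" for d z :: complex
    unfolding cmod_power2 by (simp add: inner_complex_def power2_eq_square algebra_simps)
  then have "base \<bullet> (r - p) = (cmod base)\<^sup>2 * Re \<zeta>"
    by (simp only: rp)
  then have "(base \<bullet> (r - p)) / (cmod base * cmod (r - p)) = Re u"
    using base_nonzero unfolding rp u(2) by (simp add: norm_mult power2_eq_square)
  then have \<alpha>: "arccos (Re u) = of_int a / of_int b * pi"
    using angle by (simp add: vangle_def)
  define \<alpha> where "\<alpha> = arccos (Re u)"
  have Re_u: "\<bar>Re u\<bar> \<le> 1"
    using u(1) abs_Re_le_cmod[of u] by simp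
  have cos: "cos \<alpha> = Re u"
    unfolding \<alpha>_def using Re_u by (simp add: cos_arccos_abs)
  have "(Im u)\<^sup>2 = (sin \<alpha>)\<^sup>2"
    using cos sin_cos_squared_add[of \<alpha>] cmod_power2[of u] u(1) by simp
  then have "Im u = sin \<alpha> \<or> Im u = sin (- \<alpha>)"
    by (simp add: power2_eq_iff)
  then have "u = cis \<alpha> \<or> u = cis (- \<alpha>)"
    using cos by (auto simp: complex_eq_iff)
  \<comment> \<open>The angle is unsigned; the sign of \<open>\<beta>\<close> is the orientation of the triangle.\<close>
  then obtain \<beta> where \<beta>: "\<beta> = \<alpha> \<or> \<beta> = - \<alpha>" "u = cis \<beta>"
    by blast
  have "real_of_int b * \<alpha> = real_of_int a * pi"
    using \<alpha> b by (simp add: \<alpha>_def)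
  then have "real (nat \<bar>b\<bar>) * \<alpha> = real_of_int (sgn b * a) * pi"
    by (simp add: abs_if sgn_if mult.assoc split: if_splits)
  then have "real (nat \<bar>b\<bar>) * (2 * \<beta>) = 2 * pi * real_of_int (sgn b * a) \<or>
      real (nat \<bar>b\<bar>) * (2 * \<beta>) = 2 * pi * real_of_int (- (sgn b * a))"
    using \<beta>(1) by (auto simp: algebra_simps)
  then have "cis (real (nat \<bar>b\<bar>) * (2 * \<beta>)) = 1"
    by (metis cis_multiple_2pi Ints_of_int)
  moreover have "\<zeta> / cnj \<zeta> = cis (2 * \<beta>)"
    using unit_square[OF nz] \<beta>(2) by (simp add: u_def[symmetric] cis_mult power2_eq_square)
  ultimately have "(\<zeta> / cnj \<zeta>) ^ nat \<bar>b\<bar> = 1"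
    by (simp only: Complex.DeMoivre)
  then show ?thesis
    using that nz rp by blast
qed

lemma reflect_by_root_of_unity:
  assumes angle: "vangle p q r = of_int a / of_int b * pi" and b: "b \<noteq> 0" and i: "i \<in> labels T"
  shows "\<exists>e. e ^ nat \<bar>b\<bar> = 1 \<and> (\<forall>v. reflect 0 (dir i) v = e * (rho * cnj v))"
proof -
  obtain \<zeta> where \<zeta>: "\<zeta> \<noteq> 0" "r - p = base * \<zeta>" "q - r = base * cnj \<zeta>" "(\<zeta> / cnj \<zeta>) ^ nat \<bar>b\<bar> = 1"
    using side_direction[OF angle b] by blast
  have conj: "(cnj \<zeta> / \<zeta>) ^ nat \<bar>b\<bar> = 1"
    using arg_cong[OF \<zeta>(4), of cnj] by simp
  have dirs: "dir 1 = base * \<zeta>" "dir 2 = base * cnj \<zeta>" "dir 3 = base * (- 1)"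
    using \<zeta>(2,3) by (simp_all add: dir_def edge_start_def edge_end_def)
  have "reflect 0 (d * y) v = (y / cnj y) * (d / cnj d * cnj v)" for d y v
    by (simp add: reflect_def ac_simps)
  then have refl: "reflect 0 (base * y) v = (y / cnj y) * (rho * cnj v)" for y v
    by (simp only: rho_def)
  have "i = 1 \<or> i = 2 \<or> i = 3"
    using i by (simp add: triangle_labels)
  then obtain y where "dir i = base * y" "(y / cnj y) ^ nat \<bar>b\<bar> = 1"
  proof (elim disjE)
    assume "i = 1"
    then show ?thesis
      using that[of \<zeta>] dirs(1) \<zeta>(4) by simp
  next
    assume "i = 2"
    then show ?thesis
      using that[of "cnj \<zeta>"] dirs(2) conj by simp
  next
    assume "i = 3"
    then show ?thesis
      using that[of "- 1"] dirs(3) by simp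
  qed
  then show ?thesis
    using refl[of y] by auto
qed

text \<open>The orbit of \<open>\<theta>\<close> under the dihedral group generated by the reflections \<open>v \<mapsto> e * (rho * cnj v)\<close> with
  \<open>e ^ B = 1\<close>; the two parts are its images under rotations and under reflections.\<close>

definition directions :: "nat \<Rightarrow> complex \<Rightarrow> complex set" where
  "directions B \<theta> = (\<lambda>z. z * \<theta>) ` {z. z ^ B = 1} \<union> (\<lambda>z. z * (rho * cnj \<theta>)) ` {z. z ^ B = 1}"

lemma itinerary_directions:
  assumes it: "itinerary \<sigma> F D"
    and angle: "vangle p q r = of_int a / of_int b * pi" and b: "b \<noteq> 0"
  shows "D n \<in> directions (nat \<bar>b\<bar>) (D 0)"
proof (induction n)
  case 0
  have "D 0 = 1 * D 0" "(1 :: complex) \<in> {z. z ^ nat \<bar>b\<bar> = 1}"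
    by simp_all
  then show ?case
    unfolding directions_def by blast
next
  case (Suc n)
  let ?U = "{z :: complex. z ^ nat \<bar>b\<bar> = 1}"
  obtain e where e: "e ^ nat \<bar>b\<bar> = 1" "\<forall>v. reflect 0 (dir (\<sigma> (Suc n))) v = e * (rho * cnj v)"
    using reflect_by_root_of_unity[OF angle b itinerary_label[OF it]] by blast
  have turn: "D (Suc n) = e * (rho * cnj (D n))"
    using itinerary_turn[OF it, of n] e(2) by simp
  have U: "e * cnj z \<in> ?U" if "z \<in> ?U" for z
  proof -
    have "cnj (z ^ nat \<bar>b\<bar>) = 1"
      using that by simp
    then show ?thesis
      using e(1) by (simp add: power_mult_distrib)
  qed
  consider z where "z \<in> ?U" "D n = z * D 0" | z where "z \<in> ?U" "D n = z * (rho * cnj (D 0))"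
    using Suc unfolding directions_def by blast
  then show ?case
  proof cases
    case 1
    have "D (Suc n) = (e * cnj z) * (rho * cnj (D 0))"
      unfolding turn 1(2) by simp
    then show ?thesis
      using U[OF 1(1)] unfolding directions_def by blast
  next
    case 2
    have "D (Suc n) = (e * cnj z) * (rho * cnj rho) * D 0"
      unfolding turn 2(2) by simp
    then have "D (Suc n) = (e * cnj z) * D 0"
      by (simp only: rho_unit) simp
    then show ?thesis
      using U[OF 2(1)] unfolding directions_def by blast
  qed
qed

lemma directions_finite:
  assumes "B > 0"
  shows "finite (directions B \<theta>)" "card (directions B \<theta>) \<le> 2 * B"
proof -
  have U: "finite {z :: complex. z ^ B = 1}" "card {z :: complex. z ^ B = 1} \<le> B"
    using finite_roots_unity[of B] card_roots_unity[of B] assms by auto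
  then show "finite (directions B \<theta>)"
    by (simp add: directions_def)
  have "card (directions B \<theta>) \<le> card ((\<lambda>z. z * \<theta>) ` {z. z ^ B = 1}) + card ((\<lambda>z. z * (rho * cnj \<theta>)) ` {z. z ^ B = 1})"
    unfolding directions_def by (rule card_Un_le)
  also have "\<dots> \<le> B + B"
    by (intro add_mono order_trans[OF card_image_le[OF U(1)] U(2)])
  finally show "card (directions B \<theta>) \<le> 2 * B"
    by simp
qed

section \<open>Trajectories whose type is determined by their folded image\<close>

text \<open>The set of directions that the theorem asserts to be nowhere dense.\<close>

definition rigid :: "complex \<Rightarrow> complex set" where
  "rigid x = {\<theta> \<in> sphere 0 1. \<exists>f. is_Orb T x \<theta> f \<and>
      (\<forall>g. periodic_trajectory T g \<and> g 0 \<in> edge T 3 \<longrightarrow>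
         same_type (folded_triangle p q r) (fold_map p q r \<circ> f) (fold_map p q r \<circ> g) \<longrightarrow> same_type T f g)}"

text \<open>The mirror image of the path has the same folded image, hence the same type up to reversal. Without
  reversal every strike would be on an edge that the mirror preserves, the base, which is impossible for
  two successive strikes. So the mirror reverses the type and there is a companion. The last conclusion
  expresses that time 1 is the first return: two equal states \<open>i < j\<close> within the period would bring the
  path back to the start at strike \<open>i + (k - j)\<close>.\<close>

lemma rigid_itinerary:
  assumes x: "x \<in> edge T 3" and \<theta>: "\<theta> \<in> rigid x"
  obtains k \<sigma> F D where "k > 0" "itinerary \<sigma> F D" "\<And>n. norm (D n) = 1" "F 0 = x" "D 0 = \<theta>" "F k = x"
    "itinerary \<sigma> (\<lambda>n. mirror (F (k - n mod k))) D"
    "\<And>i j. i < j \<Longrightarrow> j < k \<Longrightarrow> \<exists>n. \<not> (D (j + n) = D (i + n) \<and> F (j + n) = F (i + n))"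
proof -
  obtain f where norm_\<theta>: "norm \<theta> = 1" and orb: "is_Orb T x \<theta> f"
    and uniq: "\<And>g. periodic_trajectory T g \<Longrightarrow> g 0 \<in> edge T 3 \<Longrightarrow>
       same_type (folded_triangle p q r) (fold_map p q r \<circ> f) (fold_map p q r \<circ> g) \<Longrightarrow> same_type T f g"
    using \<theta> unfolding rigid_def by auto
  obtain c' where f: "periodic_trajectory T f" "f 0 = x" and c': "c' > 0" "departs f 0 (c' *\<^sub>R \<theta>)"
    and first: "\<And>t. 0 < t \<Longrightarrow> t < 1 \<Longrightarrow> \<not> (f t = x \<and> departs f t (c' *\<^sub>R \<theta>))"
    using orb unfolding is_Orb_def by auto
  obtain c where pb: "periodic_billiard T f c"
    using periodic_billiardI[OF f(1)] by blast
  then interpret periodic_billiard T f c .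
  have label3: "3 \<in> labels T"
    by (simp add: triangle_labels)
  have "struck T (f 0) \<noteq> {}"
    using x f(2) label3 by (auto simp: struck_def)
  then obtain k t \<sigma> F D where k: "k > 0" and it: "itinerary \<sigma> F D"
    and per: "\<And>n. \<sigma> (n + k) = \<sigma> n" "\<And>n. F (n + k) = F n" "\<And>n. D (n + k) = D n"
    and norm_D: "\<And>n. norm (D n) = 1"
    and strikes: "\<And>n. n < k \<Longrightarrow> f (t n) = F n \<and> departs f (t n) (c *\<^sub>R D n)"
    and t: "t 0 = 0" "\<And>n. 0 < n \<Longrightarrow> n < k \<Longrightarrow> 0 < t n \<and> t n < 1"
    and type: "comb_type T f = map (\<lambda>n. {\<sigma> n}) [0..<k]"
    and rev_type: "comb_type T (reversepath f) = map (\<lambda>n. {\<sigma> (k - n)}) [0..<k]"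
    by (rule periodic_itinerary) blast
  have F0: "F 0 = x" and "departs f 0 (c *\<^sub>R D 0)"
    using strikes[of 0] k t f by auto
  then have cD: "c *\<^sub>R D 0 = c' *\<^sub>R \<theta>"
    using c' departs_unique by blast
  then have "c = c'"
    using norm_D[of 0] norm_\<theta> c_pos c'(1) by (metis abs_of_pos mult.right_neutral norm_scaleR)
  then have D0: "D 0 = \<theta>"
    using cD c'(1) by simp
  have \<sigma>0: "\<sigma> 0 = 3"
    using edge_unique[OF itinerary_nonvertex[OF it] itinerary_label[OF it] label3 itinerary_edge[OF it], of 0] x F0
    by simp
  have "same_type T f (mirror \<circ> f)"
  proof (rule uniq)
    show "periodic_trajectory T (mirror \<circ> f)"
      using f(1) by (rule mirror_periodic_trajectory)
    show "(mirror \<circ> f) 0 \<in> edge T 3"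
      using mirror_in_edge[OF label3 x] f(2) by (simp add: swap_def)
    have "fold_map p q r \<circ> (mirror \<circ> f) = fold_map p q r \<circ> f"
      by (auto simp: fold_map_mirror)
    then show "same_type (folded_triangle p q r) (fold_map p q r \<circ> f) (fold_map p q r \<circ> (mirror \<circ> f))"
      by (simp add: same_type_def)
  qed
  then consider "\<And>n. n < k \<Longrightarrow> \<sigma> n = swap (\<sigma> n)" | "\<And>n. n < k \<Longrightarrow> \<sigma> (k - n) = swap (\<sigma> n)"
    unfolding same_type_def comb_type_mirror type rev_type by (auto simp: map_eq_conv)
  then have symm: "\<sigma> (k - n) = swap (\<sigma> n)" if "n < k" for n
  proof cases
    case 1
    have "\<sigma> (Suc 0) \<noteq> \<sigma> 0"
      by (rule itinerary_label_Suc[OF it])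
    moreover have "\<sigma> (Suc 0) = \<sigma> 0"
    proof (cases "k = 1")
      case True
      then show ?thesis
        using per(1)[of 0] by simp
    next
      case False
      then have "\<sigma> (Suc 0) = swap (\<sigma> (Suc 0))"
        using 1[of "Suc 0"] k by simp
      then show ?thesis
        using itinerary_label[OF it, of "Suc 0"] \<sigma>0 by (auto simp: swap_def triangle_labels)
    qed
    ultimately show ?thesis
      by blast
  qed (use that in simp)
  show ?thesis
  proof (rule that[of k \<sigma> F D])
    show "itinerary \<sigma> (\<lambda>n. mirror (F (k - n mod k))) D"
      using mirror_companion[OF it k per \<sigma>0 symm] .
    show "F k = x"
      using per(2)[of 0] F0 by simp
    show "\<exists>n. \<not> (D (j + n) = D (i + n) \<and> F (j + n) = F (i + n))" if ij: "i < j" "j < k" for i j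
    proof (rule ccontr)
      assume "\<not> ?thesis"
      then have same: "D (j + n) = D (i + n)" "F (j + n) = F (i + n)" for n
        by auto
      let ?m = "i + (k - j)"
      have m: "0 < ?m" "?m < k" "j + (k - j) = k"
        using ij by auto
      have "D ?m = D 0" "F ?m = F 0"
        using same[of "k - j"] per(2,3)[of 0] m(3) by auto
      then show False
        using first[of "t ?m"] strikes[OF m(2)] t(2)[OF m(1,2)] F0 D0 \<open>c = c'\<close> by simp
    qed
  qed (use k it norm_D F0 D0 in auto)
qed

text \<open>On the base the mirror is the point reflection in the centre.\<close>

lemma mirror_offset_nonzero:
  assumes "x \<in> edge T 3" "x \<noteq> centre"
  shows "mirror x - x \<noteq> 0"
proof
  assume "mirror x - x = 0"
  then have "x - centre = - reflect 0 base (x - centre)"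
    by (simp add: mirror_eq algebra_simps)
  moreover have "reflect 0 base (x - centre) = x - centre"
  proof -
    have "centre \<in> edge T 3"
      using midpoint_in_closed_segment[of q p] by (simp add: triangle_edges midpoint_sym)
    then have "reflect 0 (dir 3) (x - centre) = x - centre"
      using reflect_edge_diff[of 3 x centre] assms(1) by (simp add: triangle_labels)
    moreover have "dir 3 = - base"
      by (simp add: dir_def edge_start_def edge_end_def)
    ultimately show ?thesis
      using reflect_0_uminus_axis[of base "x - centre"] by simp
  qed
  ultimately have "x - centre = - (x - centre)"
    by simp
  then show False
    using assms(2) by (simp add: complex_eq_iff)
qed

text \<open>The strip between a path and its mirrored reversal has width at least \<open>w\<close>, so it cannot pass
  through the triangle too often before closing up. There are finitely many words of bounded length,
  and each is the type of at most one direction.\<close>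

lemma finite_rigid:
  assumes angle: "vangle p q r = of_int a / of_int b * pi" and b: "b \<noteq> 0"
    and x: "x \<in> edge T 3" and w: "w > 0"
  shows "finite {\<theta> \<in> rigid x. w \<le> \<bar>cross (mirror x - x) \<theta>\<bar>}"
proof -
  define B where "B = nat \<bar>b\<bar>"
  have B: "B > 0"
    using b by (simp add: B_def)
  have "compact (convex hull set T)"
    by (simp add: compact_convex_hull finite_imp_compact)
  then obtain C where C: "finite C" "convex hull set T \<subseteq> (\<Union>z\<in>C. ball z (w / 2))"
    using w unfolding compact_eq_totally_bounded by (meson half_gt_zero)
  define N where "N = length T * (2 * (2 * B * card C))"
  let ?words = "{ws. set ws \<subseteq> labels T \<and> length ws \<le> N}"
  have "{\<theta> \<in> rigid x. w \<le> \<bar>cross (mirror x - x) \<theta>\<bar>} \<subseteq> (\<lambda>ws. sgn (unfold_word ws x - x)) ` ?words"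
  proof
    fix \<theta>
    assume "\<theta> \<in> {\<theta> \<in> rigid x. w \<le> \<bar>cross (mirror x - x) \<theta>\<bar>}"
    then have \<theta>: "\<theta> \<in> rigid x" and width: "w \<le> \<bar>cross (mirror x - x) \<theta>\<bar>"
      by auto
    obtain k \<sigma> F D where k: "k > 0" and it: "itinerary \<sigma> F D" and norm: "\<And>n. norm (D n) = 1"
      and start: "F 0 = x" "D 0 = \<theta>" "F k = x"
      and G: "itinerary \<sigma> (\<lambda>n. mirror (F (k - n mod k))) D"
      and primitive: "\<And>i j. i < j \<Longrightarrow> j < k \<Longrightarrow> \<exists>n. \<not> (D (j + n) = D (i + n) \<and> F (j + n) = F (i + n))"
      using rigid_itinerary[OF x \<theta>] by blast
    have "k \<le> N"
    proof (rule ccontr)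
      assume "\<not> k \<le> N"
      then have "length T * (2 * (2 * B * card C)) < k"
        by (simp add: N_def)
      moreover have "w \<le> \<bar>cross (mirror (F (k - 0 mod k)) - F 0) (D 0)\<bar>"
        using width start by simp
      ultimately obtain i j where "i < j" "j < k"
        "\<forall>n. \<sigma> (j + n) = \<sigma> (i + n) \<and> D (j + n) = D (i + n) \<and> F (j + n) = F (i + n)"
        using early_return[OF it G norm _ directions_finite[OF B, of "D 0"]
            itinerary_directions[OF it angle b, folded B_def] C] by blast
      then show False
        using primitive by blast
    qed
    then have "map \<sigma> [1..<Suc k] \<in> ?words"
      using itinerary_label[OF it] by (auto simp del: upt_Suc)
    moreover have "\<theta> = sgn (unfold_word (map \<sigma> [1..<Suc k]) x - x)"
      using direction_from_word[OF it k _ norm] start by metis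
    ultimately show "\<theta> \<in> (\<lambda>ws. sgn (unfold_word ws x - x)) ` ?words"
      by blast
  qed
  moreover have "finite ?words"
    by (rule finite_lists_length_le) (simp add: labels_def)
  ultimately show ?thesis
    by (meson finite_imageI finite_subset)
qed

end

section \<open>From finiteness off two points to nowhere density\<close>

text \<open>The circle is connected and so has no isolated point.\<close>

lemma open_in_circle_infinite:
  fixes V :: "complex set"
  assumes "openin (top_of_set (sphere 0 1)) V" "V \<noteq> {}"
  shows "infinite V"
proof -
  obtain y where y: "y \<in> V"
    using assms(2) by blast
  obtain O' where O': "open O'" "V = sphere 0 1 \<inter> O'"
    using assms(1) openin_open by metis
  have "(1 :: complex) \<in> sphere 0 1" "(- 1 :: complex) \<in> sphere 0 1"
    by auto
  then have "sphere 0 1 \<noteq> {z}" for z :: complex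
    by (metis singletonD one_neq_neg_one)
  then have "y islimpt sphere (0 :: complex) 1"
    using y O' by (intro connected_imp_perfect connected_sphere) auto
  then show ?thesis
    using y O' unfolding islimpt_eq_acc_point by (metis IntD2 Int_commute)
qed

text \<open>An arc inside the closure contains a smaller arc that avoids the two directions parallel to \<open>d\<close>,
  where \<open>cross d\<close> vanishes. There the set is finite, hence closed, and cannot be dense in the arc.\<close>

lemma nowhere_dense_if_finite_away:
  assumes S: "S \<subseteq> sphere 0 1" and d: "d \<noteq> 0"
    and fin: "\<And>w. w > 0 \<Longrightarrow> finite {\<theta> \<in> S. w \<le> \<bar>cross d \<theta>\<bar>}"
  shows "nowhere_dense_in (top_of_set (sphere 0 1)) S"
proof -
  let ?X = "top_of_set (sphere (0 :: complex) 1)"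
  have no_open: False if V: "openin ?X V" "V \<noteq> {}" "V \<subseteq> ?X closure_of S" for V
  proof -
    have "{\<theta> \<in> sphere 0 1. cross d \<theta> = 0} \<subseteq> {sgn d, - sgn d}"
    proof
      fix \<theta>
      assume "\<theta> \<in> {\<theta> \<in> sphere 0 1. cross d \<theta> = 0}"
      then have \<theta>: "norm \<theta> = 1" "cross d \<theta> = 0"
        by auto
      then obtain s where s: "\<theta> = s *\<^sub>R d"
        using reflect_0_eq_self_if_cross_eq_0[OF d] reflect_0_eq_self_iff[OF d] by blast
      then have "\<bar>s\<bar> = 1 / norm d"
        using \<theta>(1) d by (simp add: field_simps)
      then have "s = 1 / norm d \<or> s = - (1 / norm d)"
        by linarith
      then show "\<theta> \<in> {sgn d, - sgn d}"
        using s by (auto simp: sgn_div_norm inverse_eq_divide)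
    qed
    then have "\<not> V \<subseteq> {\<theta> \<in> sphere 0 1. cross d \<theta> = 0}"
      using open_in_circle_infinite[OF V(1,2)] by (meson finite.emptyI finite.insertI finite_subset)
    then obtain \<theta>1 where \<theta>1: "\<theta>1 \<in> V" "cross d \<theta>1 \<noteq> 0"
      using openin_subset[OF V(1)] by auto
    define w where "w = \<bar>cross d \<theta>1\<bar> / 2"
    have w: "w > 0" "w < \<bar>cross d \<theta>1\<bar>"
      using \<theta>1 by (auto simp: w_def)
    define V' where "V' = V \<inter> {\<theta>. w < \<bar>cross d \<theta>\<bar>}"
    have "open {\<theta>. w < \<bar>cross d \<theta>\<bar>}"
      unfolding cross_def by (intro open_Collect_less continuous_intros)
    then have V': "openin ?X V'"
      unfolding V'_def using V(1) by (simp add: openin_Int_open)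
    have "V' \<noteq> {}"
      using \<theta>1 w by (auto simp: V'_def)
    let ?A = "{\<theta> \<in> S. w \<le> \<bar>cross d \<theta>\<bar>}"
    have "\<not> V' \<subseteq> ?A"
      using open_in_circle_infinite[OF V' \<open>V' \<noteq> {}\<close>] fin[OF w(1)] finite_subset by blast
    then obtain y where y: "y \<in> V' - ?A"
      by blast
    define W where "W = V' - ?A"
    have "openin ?X W"
      unfolding W_def using V' fin[OF w(1)] S
      by (intro openin_diff finite_imp_closedin) auto
    moreover have "y \<in> ?X closure_of S"
      using y V(3) by (auto simp: V'_def)
    moreover have "y \<in> W"
      using y by (simp add: W_def)
    ultimately obtain z where "z \<in> S" "z \<in> W"
      unfolding in_closure_of by blast
    then show False
      by (auto simp: V'_def W_def)
  qed
  have "?X interior_of (?X closure_of S) = {}"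
    using no_open[OF openin_interior_of _ interior_of_subset] by blast
  then show ?thesis
    using S by (simp add: nowhere_dense_in_def)
qed

theorem theorem1p7:
  fixes p q r x :: complex and a b :: int
  defines "T \<equiv> iso_triangle p q r"
    and "T' \<equiv> folded_triangle p q r"
    and "\<pi>' \<equiv> fold_map p q r"
  assumes nondegenerate: "\<not> collinear {p, q, r}"
    and isosceles: "dist p r = dist q r"
    and base_angle: "vangle p q r = of_int a / of_int b * pi"
    and "odd b"
    and x_in_base: "x \<in> edge T 3"
    and x_not_center: "x \<noteq> midpoint p q"
  shows "nowhere_dense_in (top_of_set (sphere 0 1))
    {\<theta> \<in> sphere 0 1. \<exists>f. is_Orb T x \<theta> f \<and>
      (\<forall>g. periodic_trajectory T g \<and> g 0 \<in> edge T 3 \<longrightarrow>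
         same_type T' (\<pi>' \<circ> f) (\<pi>' \<circ> g) \<longrightarrow> same_type T f g)}"
proof -
  interpret isosceles_triangle p q r
    by (rule isosceles_triangle.intro) (fact nondegenerate, fact isosceles)
  have x: "x \<in> edge [p, r, q] 3"
    using x_in_base by (simp add: T_def iso_triangle_def)
  have b: "b \<noteq> 0"
    using \<open>odd b\<close> by auto
  have "nowhere_dense_in (top_of_set (sphere 0 1)) (rigid x)"
  proof (rule nowhere_dense_if_finite_away)
    show "rigid x \<subseteq> sphere 0 1"
      by (auto simp: rigid_def)
    show "mirror x - x \<noteq> 0"
      using mirror_offset_nonzero[OF x x_not_center] .
    show "finite {\<theta> \<in> rigid x. w \<le> \<bar>cross (mirror x - x) \<theta>\<bar>}" if "w > 0" for w
      using finite_rigid[OF base_angle b x that] .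
  qed
  then show ?thesis
    by (simp add: rigid_def T_def T'_def \<pi>'_def iso_triangle_def)
qed

end
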